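(* Let $d$ be a positive integer and let $f\colon\mathbb{R}^d\to[0,\infty)$ be an upper semi-continuous log-concave function of finite positive integral. Then the following assertions are equivalent: (1) $\liminf_{s\to\infty}\int_{\mathbb{R}^d}{}^{(s)}L_f<\infty$; (2) there exists a Gaussian density $G$ such that $f\le G$; (3) there exists a unique solution to the problem $$\min_{\ell\in\mathcal{E}^d[\psi_\infty]}\int_{\mathbb{R}^d}\ell\quad\text{subject to}\quad f\le\ell,$$ and, also, the Löwner $s$-functions ${}^{(s)}L_f$ of $f$ converge uniformly on $\mathbb{R}^d$ to the solution to this problem as $s\to\infty$.
   Context: $|\cdot|$ denotes the Euclidean norm. A function $f\colon\mathbb{R}^d\to[0,\infty)$ is log-concave if $f=e^{-\varphi}$ for a convex function $\varphi\colon\mathbb{R}^d\to\mathbb{R}\cup\{+\infty\}$ (with $e^{-\infty}=0$). The relation $f_1\le f_2$ means $f_1(x)\le f_2(x)$ for all $x\in\mathbb{R}^d$. The function $\psi_s\colon[0,\infty)\to[0,\infty)$ is defined by $\psi_0(t)=t$, $\psi_\infty(t)=t^2$ and, for $s\in(0,\infty)$, $$\psi_s(t)=\frac{s}{2}\left[\sqrt{1+4\left(\tfrac{t}{s}\right)^2}-\ln\left(\frac{1+\sqrt{1+4(t/s)^2}}{2}\right)-1\right].$$ For $s\in[0,\infty]$, $\mathcal{E}^d[\psi_s]$ is the class of functions on $\mathbb{R}^d$ of the form $x\mapsto\alpha e^{-\psi_s(|A(x-a)|)}$ with $A\in\mathrm{GL}(d)$, $\alpha>0$, $a\in\mathbb{R}^d$.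 A Gaussian density is an element of $\mathcal{E}^d[\psi_\infty]$, i.e. a function of the form $x\mapsto\alpha e^{-|A(x-a)|^2}$ (no normalization of the integral is assumed). For $s\in[0,\infty)$, the Löwner $s$-function ${}^{(s)}L_f$ of $f$ is the (existing and unique) function $\ell\in\mathcal{E}^d[\psi_s]$ that minimizes $\int_{\mathbb{R}^d}\ell$ subject to $f\le\ell$. *)

theory Defs
  imports "HOL-Analysis.Analysis"
begin

definition upper_semicontinuous :: "('a::topological_space \<Rightarrow> real) \<Rightarrow> bool" where
  "upper_semicontinuous f \<longleftrightarrow> (\<forall>x. \<forall>c>f x. \<forall>\<^sub>F y in nhds x. f y < c)"

definition convex_extended :: "('a::real_vector \<Rightarrow> ereal) \<Rightarrow> bool" where
  "convex_extended \<phi> \<longleftrightarrow> (\<forall>x. \<phi> x \<noteq> -\<infinity>) \<and>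
     (\<forall>x y. \<forall>u>0. \<forall>v>0. u + v = 1 \<longrightarrow>
        \<phi> (u *\<^sub>R x + v *\<^sub>R y) \<le> ereal u * \<phi> x + ereal v * \<phi> y)"

text \<open>The value at \<open>-\<infinity>\<close> is irrelevant; it never occurs below.\<close>

definition exp_neg :: "ereal \<Rightarrow> real" where
  "exp_neg t = (if t = \<infinity> then 0 else exp (- real_of_ereal t))"

definition log_concave :: "('a::real_vector \<Rightarrow> real) \<Rightarrow> bool" where
  "log_concave f \<longleftrightarrow> (\<exists>\<phi>. convex_extended \<phi> \<and> f = (\<lambda>x. exp_neg (\<phi> x)))"

text \<open>The parameter ranges over \<open>[0, \<infinity>]\<close>; only arguments \<open>t \<ge> 0\<close> are meaningful.\<close>

definition psi :: "ennreal \<Rightarrow> real \<Rightarrow> real" where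
  "psi s t =
     (if s = 0 then t
      else if s = \<infinity> then t\<^sup>2
      else let r = enn2real s; w = sqrt (1 + 4 * (t / r)\<^sup>2)
           in r / 2 * (w - ln ((1 + w) / 2) - 1))"

definition ellipsoidal_class :: "(real \<Rightarrow> real) \<Rightarrow> (real ^ 'n \<Rightarrow> real) set" where
  "ellipsoidal_class \<psi> =
     {\<lambda>x. \<alpha> * exp (- \<psi> (norm (A *v (x - a)))) | (A :: real ^ 'n ^ 'n) \<alpha> a.
        invertible A \<and> \<alpha> > 0}"

definition gaussian_density :: "(real ^ 'n \<Rightarrow> real) \<Rightarrow> bool" where
  "gaussian_density G \<longleftrightarrow> G \<in> ellipsoidal_class (psi \<infinity>)"

text \<open>
  Integrals of non-negative functions are taken in \<open>[0, \<infinity>]\<close>, so that no integrability side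
  conditions are needed.
\<close>

definition solves_loewner_problem ::
  "ennreal \<Rightarrow> (real ^ 'n \<Rightarrow> real) \<Rightarrow> (real ^ 'n \<Rightarrow> real) \<Rightarrow> bool" where
  "solves_loewner_problem s f l \<longleftrightarrow>
     l \<in> ellipsoidal_class (psi s) \<and> f \<le> l \<and>
     (\<forall>l' \<in> ellipsoidal_class (psi s). f \<le> l' \<longrightarrow>
        (\<integral>\<^sup>+ x. ennreal (l x) \<partial>lborel) \<le> (\<integral>\<^sup>+ x. ennreal (l' x) \<partial>lborel))"

text \<open>
  For \<open>s < \<infinity>\<close> and an upper semicontinuous log-concave \<open>f\<close> of finite positive integral, the
  solution exists and is unique as a function, although its parameters are not (\<open>A\<close> may be replaced
  by \<open>U ** A\<close> with \<open>U\<close> orthogonal).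
\<close>

definition loewner_function :: "real \<Rightarrow> (real ^ 'n \<Rightarrow> real) \<Rightarrow> real ^ 'n \<Rightarrow> real" where
  "loewner_function s f = (THE l. solves_loewner_problem (ennreal s) f l)"

end

theory Submission
  imports Defs
begin

text \<open>
  Up to a rescaling of the argument, \<open>\<psi>\<^sub>s\<close> increases to \<open>t\<^sup>2\<close> as \<open>s\<close> tends to infinity, and a function
  \<open>\<alpha> exp (- \<psi> \<bar>A x + b\<bar>)\<close> has integral \<open>\<alpha> / \<bar>det A\<bar>\<close> times a constant depending only on \<open>\<psi>\<close>. So
  all the problems, for finite \<open>s\<close> as for Gaussians, minimise \<open>\<alpha> / \<bar>det A\<bar>\<close>.

  Uniqueness: the geometric mean of two majorants is majorised by the function with averaged \<open>A\<close>
  and \<open>b\<close>, and after an orthogonal change of one of the matrices the determinant of the average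
  exceeds the geometric mean of the determinants unless the matrices agree. Two different centres
  leave a gap that permits a slightly smaller majorant.

  Compactness: \<open>f\<close> is bounded below on some ball, so bounded \<open>\<alpha> / \<bar>det A\<bar>\<close> confines all parameters to
  a compact set, uniformly in \<open>s \<ge> 1\<close>. This yields the existence of minimisers and makes each
  sequence of Loewner functions subconverge to a Gaussian majorant. As a Gaussian majorant stays
  feasible for every \<open>s\<close>, that limit is the optimal one. For finite \<open>s\<close> a majorant exists because \<open>f\<close>
  decays exponentially and \<open>\<psi>\<^sub>s\<close> grows linearly.
\<close>

section \<open>Singular values and determinants\<close>

text \<open>Without rescaling there is no limit to speak of: for small t / s the original profile is
  about t^2 / (2 s), so it tends to 0 for each fixed t. The matrix absorbs a factor in the argument,
  hence t may be replaced by sqrt (2 s) t without changing the class; this is the origin of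
  \<open>psi_scaled\<close>, whose limit is t^2. The constants in the integrals still depend on s,
  but for s \<ge> 1 they lie between the constants of t^2 and of \<open>psi_scaled 1\<close>, so
  bounded integrals and bounded ratios \<alpha> / |det A| amount to the same.

  One line \<kappa> (t - 1), with \<kappa> = \<open>psi_scaled 1 1\<close>, lies below all profiles
  with s \<ge> 1 and below t^2. It is used twice: it makes the compactness bounds independent of s,
  and it confines the points where two functions differ by at least e to a bounded set, so that
  convergence of the parameters becomes uniform convergence on the whole space.

  Linear algebra and integration meet in the singular value decomposition: it yields both the strict
  determinant inequality for averages and the change of variables formula.\<close>

lemma compact_orthogonal_matrices:
  "compact {U :: real^'n^'n. orthogonal_matrix U}"
proof (rule compact_eq_bounded_closed[THEN iffD2], rule conjI)
  have bnd: "norm U \<le> real CARD('n)" if U: "orthogonal_matrix U" for U :: "real^'n^'n"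
  proof -
    have "norm (U $ i) = 1" for i
      using U unfolding orthogonal_matrix_orthonormal_rows by (auto simp: row_def)
    then have "(\<Sum>i\<in>UNIV. norm (U $ i)) = real CARD('n)" by simp
    then show ?thesis
      using L2_set_le_sum[of UNIV "\<lambda>i. norm (U $ i)"] by (simp add: norm_vec_def[of U])
  qed
  then show "bounded {U :: real^'n^'n. orthogonal_matrix U}"
    by (auto simp: bounded_iff)
  have "{U :: real^'n^'n. orthogonal_matrix U} =
      (\<Inter>i. \<Inter>j. {U. (\<Sum>k\<in>UNIV. U $ k $ i * U $ k $ j) = (if i = j then 1 else 0)})"
    by (auto simp: orthogonal_matrix vec_eq_iff matrix_matrix_mult_def transpose_def mat_def)
  also have "closed \<dots>"
    by (intro closed_INT ballI closed_Collect_eq continuous_intros)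
  finally show "closed {U :: real^'n^'n. orthogonal_matrix U}" .
qed

lemma matrix_mult_add_left:
  fixes A B C :: "real^'n^'n"
  shows "(A + B) ** C = A ** C + B ** C"
  by (simp add: matrix_matrix_mult_def vec_eq_iff sum.distrib distrib_right)

lemma row_eq_nth: "row i A = A $ i"
  by (simp add: row_def vec_eq_iff)

lemma matrix_mul_row_combination:
  fixes G M :: "real^'n^'n"
  assumes "G $ k = a *\<^sub>R axis i 1 + b *\<^sub>R axis j 1"
  shows "(G ** M) $ k $ l = a * M $ i $ l + b * M $ j $ l"
proof -
  have "G $ k $ m = a * (if m = i then 1 else 0) + b * (if m = j then 1 else 0)" for m
    using assms by (simp add: axis_def)
  then have "(G ** M) $ k $ l = (\<Sum>m\<in>UNIV. a * (if m = i then M $ m $ l else 0) + b * (if m = j then M $ m $ l else 0))"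
    unfolding matrix_matrix_mult_def by (auto simp: algebra_simps intro!: sum.cong)
  also have "\<dots> = a * M $ i $ l + b * M $ j $ l"
    by (simp add: sum.distrib flip: sum_distrib_left)
  finally show ?thesis .
qed

text \<open>On the unit circle the linear form c a + s b has maximum sqrt (a^2 + b^2), attained in
  the direction (a, b). If (1, 0) is a maximum point too, then b vanishes.\<close>

lemma rotation_maximal_imp_zero:
  fixes a b :: real
  assumes "\<And>c s. c\<^sup>2 + s\<^sup>2 = 1 \<Longrightarrow> c * a + s * b \<le> a"
  shows "b = 0"
proof (rule ccontr)
  assume b: "b \<noteq> 0"
  define r where "r = sqrt (a\<^sup>2 + b\<^sup>2)"
  have r2: "r\<^sup>2 = a\<^sup>2 + b\<^sup>2" by (simp add: r_def)
  have r0: "r > 0" using b by (simp add: r_def sum_power2_gt_zero_iff)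
  have "(a/r)\<^sup>2 + (b/r)\<^sup>2 = 1" using r0 by (simp add: power_divide flip: r2 add_divide_distrib)
  from assms[OF this] have "(a\<^sup>2 + b\<^sup>2) / r \<le> a" by (simp add: power2_eq_square add_divide_distrib)
  then have "r * r \<le> a * r" using r2 r0 by (simp add: pos_divide_le_eq power2_eq_square)
  then have "r \<le> a" using r0 by simp
  moreover have "r > \<bar>a\<bar>" unfolding r_def using b
    by (metis add.commute less_add_same_cancel2 real_sqrt_abs real_sqrt_less_iff zero_less_power2)
  ultimately show False by linarith
qed

text \<open>A rotation in the plane of i and j touches only the diagonal entries i and j. It turns
  the weighted trace into c times the old contribution plus s times
  \<open>w i * M $ j $ i - w j * M $ i $ j\<close>, so maximality at the identity kills this
  difference. The sign of a diagonal entry comes from the reflection that negates row i.\<close>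

lemma weighted_trace_maximal:
  fixes M :: "real^'n^'n" and w :: "'n \<Rightarrow> real"
  assumes max: "\<And>U. orthogonal_matrix U \<Longrightarrow>
      (\<Sum>k\<in>UNIV. w k * (U ** M) $ k $ k) \<le> (\<Sum>k\<in>UNIV. w k * M $ k $ k)"
  shows "w j * M $ i $ j = w i * M $ j $ i" and "w i > 0 \<Longrightarrow> M $ i $ i \<ge> 0"
proof -
  show "w j * M $ i $ j = w i * M $ j $ i"
  proof (cases "i = j")
    case False
    have "w i * M $ j $ i - w j * M $ i $ j = 0"
    proof (rule rotation_maximal_imp_zero)
      fix c s :: real assume cs: "c\<^sup>2 + s\<^sup>2 = 1"
      define G :: "real^'n^'n" where
        "G = (\<chi> k. if k = i then c *\<^sub>R axis i 1 + s *\<^sub>R axis j 1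
                 else if k = j then (-s) *\<^sub>R axis i 1 + c *\<^sub>R axis j 1
                 else 1 *\<^sub>R axis k 1 + 0 *\<^sub>R axis k 1)"
      have "orthogonal_matrix G"
        unfolding orthogonal_matrix_orthonormal_rows row_eq_nth
        using cs False
        by (auto simp: G_def norm_eq_1 orthogonal_def inner_add_left inner_add_right
            inner_diff_left inner_diff_right inner_axis_axis power2_eq_square add.commute)
      from max[OF this]
      have le: "(\<Sum>k\<in>UNIV. w k * ((G ** M) $ k $ k - M $ k $ k)) \<le> 0"
        by (simp add: right_diff_distrib sum_subtractf)
      have z: "(G ** M) $ k $ k - M $ k $ k = 0" if "k \<notin> {i, j}" for k
        using that by (subst matrix_mul_row_combination[where a=1 and b=0 and i=k and j=k]) (auto simp: G_def)
      have "(\<Sum>k\<in>UNIV. w k * ((G ** M) $ k $ k - M $ k $ k)) = (\<Sum>k\<in>{i,j}. w k * ((G ** M) $ k $ k - M $ k $ k))"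
        using z by (intro sum.mono_neutral_right) auto
      also have "\<dots> = w i * ((G ** M) $ i $ i - M $ i $ i) + w j * ((G ** M) $ j $ j - M $ j $ j)"
        using False by simp
      also have "(G ** M) $ i $ i = c * M $ i $ i + s * M $ j $ i"
        by (rule matrix_mul_row_combination) (simp add: G_def)
      also have "(G ** M) $ j $ j = (-s) * M $ i $ j + c * M $ j $ j"
        using False by (intro matrix_mul_row_combination) (simp add: G_def)
      finally show "c * (w i * M $ i $ i + w j * M $ j $ j) + s * (w i * M $ j $ i - w j * M $ i $ j) \<le> (w i * M $ i $ i + w j * M $ j $ j)"
        using le by (simp add: algebra_simps)
    qed
    then show ?thesis by simp
  qed simp
  show "M $ i $ i \<ge> 0" if "w i > 0"
  proof -
    define G :: "real^'n^'n" where "G = (\<chi> k. (if k = i then -1 else 1) *\<^sub>R axis k 1 + 0 *\<^sub>R axis k 1)"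
    have "orthogonal_matrix G"
      unfolding orthogonal_matrix_orthonormal_rows row_eq_nth
      by (auto simp: G_def norm_eq_1 orthogonal_def inner_axis_axis)
    from max[OF this]
    have "(\<Sum>k\<in>UNIV. w k * M $ k $ k - w k * (G ** M) $ k $ k) \<ge> 0"
      by (simp add: sum_subtractf)
    also have "(\<Sum>k\<in>UNIV. w k * M $ k $ k - w k * (G ** M) $ k $ k) = (\<Sum>k\<in>UNIV. if k = i then 2 * w k * M $ k $ k else 0)"
    proof (intro sum.cong refl)
      fix k
      have "(G ** M) $ k $ k = (if k = i then -1 else 1) * M $ k $ k + 0 * M $ k $ k"
        by (rule matrix_mul_row_combination) (simp add: G_def)
      then show "w k * M $ k $ k - w k * (G ** M) $ k $ k = (if k = i then 2 * w k * M $ k $ k else 0)" by simp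
    qed
    finally show ?thesis using that by (simp add: zero_le_mult_iff)
  qed
qed

text \<open>The orthogonal factors maximise a trace with distinct positive weights; stationarity under
  plane rotations from either side then forces the product to be diagonal.\<close>

lemma singular_value_decomposition:
  fixes B :: "real^'n^'n"
  obtains U V D where "orthogonal_matrix U" "orthogonal_matrix V" "U ** B ** V = D"
    "\<And>i j. i \<noteq> j \<Longrightarrow> D $ i $ j = 0" "\<And>i. D $ i $ i \<ge> 0"
proof -
  \<comment> \<open>An injective numbering of the indices supplies positive weights with pairwise
    distinct squares.\<close>
  obtain h :: "'n \<Rightarrow> nat" where h: "inj h"
    using finite_imp_inj_to_nat_seg[OF finite_class.finite_UNIV] by blast
  define w where "w k = real (h k) + 1" for k
  have w: "w k > 0" for k by (simp add: w_def)
  have wij: "(w i)\<^sup>2 \<noteq> (w j)\<^sup>2" if "i \<noteq> j" for i j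
    using that h w[of i] w[of j] by (auto simp: power2_eq_iff w_def inj_eq)
  define T where "T M = (\<Sum>k\<in>UNIV. w k * M $ k $ k)" for M :: "real^'n^'n"
  let ?O = "{U :: real^'n^'n. orthogonal_matrix U}"
  have cont: "continuous_on (?O \<times> ?O) (\<lambda>p. T (fst p ** B ** snd p))"
    unfolding T_def matrix_matrix_mult_def
    by (simp) (intro continuous_intros)
  have "?O \<times> ?O \<noteq> {}" using orthogonal_matrix_id by auto
  from continuous_attains_sup[OF compact_Times[OF compact_orthogonal_matrices compact_orthogonal_matrices] this cont]
  obtain U V where UV: "orthogonal_matrix U" "orthogonal_matrix V"
    and mx: "\<And>U' V'. orthogonal_matrix U' \<Longrightarrow> orthogonal_matrix V' \<Longrightarrow> T (U' ** B ** V') \<le> T (U ** B ** V)"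
    by force
  define D where "D = U ** B ** V"
  have L: "T (W ** D) \<le> T D" if "orthogonal_matrix W" for W
    using mx[OF orthogonal_matrix_mul[OF that UV(1)] UV(2)] by (simp add: D_def matrix_mul_assoc)
  have R: "T (W ** transpose D) \<le> T (transpose D)" if "orthogonal_matrix W" for W
  proof -
    have "orthogonal_matrix (V ** transpose W)"
      using that UV by (simp add: orthogonal_matrix_mul)
    from mx[OF UV(1) this] have "T (D ** transpose W) \<le> T D" by (simp add: D_def matrix_mul_assoc)
    moreover have "T (transpose M) = T M" for M by (simp add: T_def transpose_def)
    ultimately show ?thesis by (metis matrix_transpose_mul transpose_transpose)
  qed
  have e1: "w j * D $ i $ j = w i * D $ j $ i" for i j
    by (rule weighted_trace_maximal(1)) (use L in \<open>simp add: T_def\<close>)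
  have e2: "w j * transpose D $ i $ j = w i * transpose D $ j $ i" for i j
    by (rule weighted_trace_maximal(1)) (use R in \<open>simp add: T_def\<close>)
  \<comment> \<open>Together \<open>e1\<close> and \<open>e2\<close> give (w i)^2 D_ji = (w j)^2
    D_ji. With equal weights they would only say that \<open>D\<close> is symmetric.\<close>
  have off: "D $ i $ j = 0" if "i \<noteq> j" for i j
  proof -
    have "w i * (w j * D $ i $ j) = w i * (w i * D $ j $ i)" "w j * (w i * D $ i $ j) = w j * (w j * D $ j $ i)"
      using e1[of j i] e2[of j i] by (simp_all add: transpose_def)
    then have "w i * (w i * D $ j $ i) = w j * (w j * D $ j $ i)"
      by (metis mult.left_commute)
    then have "((w i)\<^sup>2 - (w j)\<^sup>2) * D $ j $ i = 0" by (simp add: power2_eq_square left_diff_distrib mult.assoc)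
    then have "D $ j $ i = 0" using wij[OF that] by simp
    then show ?thesis using e1[of j i] w[of j] by simp
  qed
  have "D $ i $ i \<ge> 0" for i
    by (rule weighted_trace_maximal(2)[of w]) (use L w in \<open>simp_all add: T_def\<close>)
  with off UV show thesis using that[OF UV D_def[symmetric]] by blast
qed


section \<open>Strict determinant inequality for averages of matrices\<close>

lemma prod_sqrt_less_prod_mean:
  fixes d :: "'i::finite \<Rightarrow> real"
  assumes "\<And>i. d i > 0" "d j \<noteq> 1"
  shows "sqrt (\<Prod>i\<in>UNIV. d i) < (\<Prod>i\<in>UNIV. (1 + d i) / 2)"
proof -
  have am: "sqrt (d i) \<le> (1 + d i) / 2" for i
    using arith_geo_mean_sqrt[of 1 "d i"] assms(1)[of i] by simp
  have "sqrt (d j) < (1 + d j) / 2"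
  proof (rule ccontr)
    assume "\<not> ?thesis"
    with am[of j] have "sqrt (d j) = (1 + d j) / 2" by simp
    then have "2 * sqrt (d j) = 1 + (sqrt (d j))\<^sup>2" using assms(1)[of j] by simp
    then have "(sqrt (d j) - 1)\<^sup>2 = 0" by (simp add: power2_diff)
    then show False using assms(2) by simp
  qed
  moreover have "(\<Prod>i\<in>UNIV-{j}. sqrt (d i)) \<le> (\<Prod>i\<in>UNIV-{j}. (1 + d i) / 2)"
    using am assms(1) by (intro prod_mono) (auto intro: less_imp_le)
  moreover have "(\<Prod>i\<in>UNIV-{j}. sqrt (d i)) > 0"
    using assms(1) by (intro prod_pos) auto
  ultimately have "sqrt (d j) * (\<Prod>i\<in>UNIV-{j}. sqrt (d i)) < (1 + d j) / 2 * (\<Prod>i\<in>UNIV-{j}. (1 + d i) / 2)"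
    using assms(1)[of j] by (intro mult_less_le_imp_less) auto
  then have "(\<Prod>i\<in>UNIV. sqrt (d i)) < (\<Prod>i\<in>UNIV. (1 + d i) / 2)"
    by (simp add: prod.remove[of UNIV j])
  moreover have "(\<Prod>i\<in>F. sqrt (d i)) = sqrt (\<Prod>i\<in>F. d i)" if "finite F" for F :: "'i set"
    using that by induction (auto simp: real_sqrt_mult)
  ultimately show ?thesis by simp
qed

lemma abs_det_orthogonal:
  fixes U :: "real^'n^'n"
  assumes "orthogonal_matrix U" shows "\<bar>det U\<bar> = 1"
  using det_orthogonal_matrix[OF assms] by auto

lemma norm_orthogonal_matrix_vector:
  fixes U :: "real^'n^'n"
  assumes "orthogonal_matrix U" shows "norm (U *v x) = norm x"
  using assms orthogonal_transformation_matrix[of "(*v) U"] orthogonal_transformation_norm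
  by auto

text \<open>The plain average may be singular, as for A2 = - A1; the factor \<open>W\<close> repairs
  this. Write A2 = B A1 and U B V = D with \<open>D\<close> diagonal. Then W = V U gives W B = V D
  V^T, the positive definite part of a polar decomposition, and A1 + W A2 = V (1 + D) V^T A1. What
  remains is the inequality of arithmetic and geometric means for 1 and each diagonal entry of
  \<open>D\<close>, strict unless all entries are 1.\<close>

lemma det_mean_orthogonal:
  fixes A1 A2 :: "real^'n^'n"
  assumes inv: "invertible A1" "invertible A2"
  obtains W where "orthogonal_matrix W"
    "A1 = W ** A2 \<or> sqrt (\<bar>det A1\<bar> * \<bar>det A2\<bar>) < \<bar>det ((1/2) *\<^sub>R (A1 + W ** A2))\<bar>"
proof -
  obtain A' where A': "A' ** A1 = mat 1" using inv(1) by (auto simp: invertible_def)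
  define B where "B = A2 ** A'"
  have BA: "B ** A1 = A2"
    by (simp add: B_def A' flip: matrix_mul_assoc)
  have det0: "det A1 \<noteq> 0" "det A2 \<noteq> 0" using inv by (simp_all add: invertible_det_nz)
  obtain U V D where UV: "orthogonal_matrix U" "orthogonal_matrix V" and D: "U ** B ** V = D"
    and off: "\<And>i j. i \<noteq> j \<Longrightarrow> D $ i $ j = 0" and nn: "\<And>i. D $ i $ i \<ge> 0"
    using singular_value_decomposition[of B] by blast
  have VV: "V ** transpose V = mat 1" "transpose V ** V = mat 1"
    using UV(2) by (auto simp: orthogonal_matrix_def)
  define W where "W = V ** U"
  have W: "orthogonal_matrix W" using UV by (simp add: W_def orthogonal_matrix_mul)
  have WB: "W ** B = V ** D ** transpose V"
    unfolding W_def D[symmetric] by (simp add: matrix_mul_assoc[symmetric] VV)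
  have detD: "det D = (\<Prod>i\<in>UNIV. D $ i $ i)" using off by (rule det_diagonal)
  have "\<bar>det D\<bar> = \<bar>det U\<bar> * \<bar>det B\<bar> * \<bar>det V\<bar>" by (simp add: det_mul abs_mult flip: D)
  then have absD: "\<bar>det D\<bar> = \<bar>det B\<bar>" by (simp add: abs_det_orthogonal UV)
  have detA2: "\<bar>det A2\<bar> = \<bar>det B\<bar> * \<bar>det A1\<bar>" by (simp add: det_mul abs_mult flip: BA)
  with det0 absD have "det D \<noteq> 0" by auto
  then have pos: "D $ i $ i > 0" for i using nn[of i] detD by (auto simp: less_le)
  have absD': "\<bar>det B\<bar> = (\<Prod>i\<in>UNIV. D $ i $ i)"
    using absD detD pos by (simp add: prod_pos less_imp_le)
  have "A1 = W ** A2 \<or> sqrt (\<bar>det A1\<bar> * \<bar>det A2\<bar>) < \<bar>det ((1/2) *\<^sub>R (A1 + W ** A2))\<bar>"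
  proof (cases "\<forall>i. D $ i $ i = 1")
    case True
    with off have "D = mat 1" by (auto simp: vec_eq_iff mat_def)
    then have "W ** B = mat 1" using WB VV by simp
    then have "W ** A2 = A1" unfolding BA[symmetric] by (simp add: matrix_mul_assoc)
    then show ?thesis by simp
  next
    case False
    then obtain j where j: "D $ j $ j \<noteq> 1" by blast
    define E where "E = (1/2) *\<^sub>R (mat 1 + D)"
    have "V ** E ** transpose V = (1/2) *\<^sub>R (mat 1 + W ** B)"
      unfolding E_def WB
      by (simp add: matrix_add_ldistrib matrix_mult_add_left VV matrix_mul_assoc[symmetric] matrix_scalar_ac scalar_matrix_assoc[symmetric] scaleR_add_right)
    then have eq: "(1/2) *\<^sub>R (A1 + W ** A2) = V ** E ** transpose V ** A1"
      by (simp add: matrix_mult_add_left scalar_matrix_assoc[symmetric] BA matrix_mul_assoc[symmetric])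
    have detE: "det E = (\<Prod>i\<in>UNIV. (1 + D $ i $ i) / 2)"
      by (subst det_diagonal) (auto simp: E_def off mat_def)
    have "\<bar>det ((1/2) *\<^sub>R (A1 + W ** A2))\<bar> = \<bar>det E\<bar> * \<bar>det A1\<bar>"
      unfolding eq by (simp add: det_mul abs_mult abs_det_orthogonal UV)
    also have "\<bar>det E\<bar> = (\<Prod>i\<in>UNIV. (1 + D $ i $ i) / 2)"
      unfolding detE using pos by (intro abs_of_nonneg prod_nonneg) (auto simp: add_nonneg_nonneg less_imp_le)
    finally have r: "\<bar>det ((1/2) *\<^sub>R (A1 + W ** A2))\<bar> = (\<Prod>i\<in>UNIV. (1 + D $ i $ i) / 2) * \<bar>det A1\<bar>" .
    have "sqrt (\<bar>det A1\<bar> * \<bar>det A2\<bar>) = sqrt (\<Prod>i\<in>UNIV. D $ i $ i) * \<bar>det A1\<bar>"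
      unfolding detA2 absD' by (simp add: real_sqrt_mult algebra_simps)
    with prod_sqrt_less_prod_mean[of "\<lambda>i. D $ i $ i", OF pos j] det0 r show ?thesis by simp
  qed
  with W show thesis by (rule that)
qed

section \<open>Lebesgue integrals and linear maps\<close>

lemma measurable_matrix_vector [measurable]:
  fixes A :: "real^'n^'m"
  shows "(*v) A \<in> borel_measurable borel"
  by (intro borel_measurable_continuous_onI matrix_vector_mult_linear_continuous_on)

lemma nn_integral_lborel_translation:
  fixes h :: "'a::euclidean_space \<Rightarrow> ennreal"
  assumes [measurable]: "h \<in> borel_measurable borel"
  shows "(\<integral>\<^sup>+x. h (c + x) \<partial>lborel) = (\<integral>\<^sup>+x. h x \<partial>lborel)"
proof -
  have "(\<integral>\<^sup>+x. h x \<partial>lborel) = (\<integral>\<^sup>+x. h x \<partial>distr lborel borel ((+) c))"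
    by (simp only: lborel_distr_plus)
  also have "\<dots> = (\<integral>\<^sup>+x. h (c + x) \<partial>lborel)"
    by (subst nn_integral_distr) auto
  finally show ?thesis ..
qed

text \<open>The Fubini argument behind the uniqueness of Haar measure: the pushforward of Lebesgue
  measure under \<open>A\<close> is translation invariant, and an even function \<open>g\<close> calibrates it.\<close>

lemma nn_integral_linear_calibrate:
  fixes A :: "real^'n^'n" and g h :: "real^'n \<Rightarrow> ennreal"
  assumes A: "invertible A"
    and [measurable]: "g \<in> borel_measurable borel" "h \<in> borel_measurable borel"
    and even: "\<And>x. g (- x) = g x"
  shows "(\<integral>\<^sup>+x. g x \<partial>lborel) * (\<integral>\<^sup>+y. h (A *v y) \<partial>lborel) =
    (\<integral>\<^sup>+x. h x \<partial>lborel) * (\<integral>\<^sup>+y. g (A *v y) \<partial>lborel)"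
proof -
  obtain A' where A': "A ** A' = mat 1" using A by (auto simp: invertible_def)
  then have AA': "A *v (A' *v x) = x" for x by (simp add: matrix_vector_mul_assoc)
  have [measurable]: "(\<lambda>(x, y). g x * h (A *v y + x)) \<in> borel_measurable (borel \<Otimes>\<^sub>M borel)"
    by measurable
  have "(\<integral>\<^sup>+x. g x \<partial>lborel) * (\<integral>\<^sup>+y. h (A *v y) \<partial>lborel) =
      (\<integral>\<^sup>+x. \<integral>\<^sup>+y. g x * h (A *v y) \<partial>lborel \<partial>lborel)"
    by (simp add: nn_integral_cmult nn_integral_multc)
  \<comment> \<open>Three translations with Fubini between them: y by \<open>A' *v x\<close>, then x
    by \<open>- (A *v y)\<close>, then y by \<open>A' *v x\<close> again. They move the linear map
    from \<open>h\<close> to \<open>g\<close>, and evenness of \<open>g\<close> removes the sign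
    that is left.\<close>
  also have "\<dots> = (\<integral>\<^sup>+x. \<integral>\<^sup>+y. g x * h (A *v y + x) \<partial>lborel \<partial>lborel)"
  proof (rule nn_integral_cong)
    fix x :: "real^'n"
    have "(\<integral>\<^sup>+y. g x * h (A *v y) \<partial>lborel) = (\<integral>\<^sup>+y. g x * h (A *v (A' *v x + y)) \<partial>lborel)"
      by (rule nn_integral_lborel_translation[symmetric]) simp
    then show "(\<integral>\<^sup>+y. g x * h (A *v y) \<partial>lborel) = (\<integral>\<^sup>+y. g x * h (A *v y + x) \<partial>lborel)"
      by (simp add: matrix_vector_right_distrib AA' add.commute)
  qed
  also have "\<dots> = (\<integral>\<^sup>+y. \<integral>\<^sup>+x. g x * h (A *v y + x) \<partial>lborel \<partial>lborel)"
    by (rule lborel_pair.Fubini'[symmetric]) simp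
  also have "\<dots> = (\<integral>\<^sup>+y. \<integral>\<^sup>+x. g (- (A *v y) + x) * h x \<partial>lborel \<partial>lborel)"
  proof (rule nn_integral_cong)
    fix y :: "real^'n"
    show "(\<integral>\<^sup>+x. g x * h (A *v y + x) \<partial>lborel) = (\<integral>\<^sup>+x. g (- (A *v y) + x) * h x \<partial>lborel)"
      using nn_integral_lborel_translation[of "\<lambda>x. g x * h (A *v y + x)" "- (A *v y)"] by simp
  qed
  also have "\<dots> = (\<integral>\<^sup>+x. \<integral>\<^sup>+y. g (- (A *v y) + x) * h x \<partial>lborel \<partial>lborel)"
    by (rule lborel_pair.Fubini') simp
  also have "\<dots> = (\<integral>\<^sup>+x. \<integral>\<^sup>+y. g (A *v y) * h x \<partial>lborel \<partial>lborel)"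
  proof (rule nn_integral_cong)
    fix x :: "real^'n"
    have "(\<integral>\<^sup>+y. g (- (A *v y) + x) * h x \<partial>lborel) = (\<integral>\<^sup>+y. g (- (A *v (A' *v x + y)) + x) * h x \<partial>lborel)"
      by (rule nn_integral_lborel_translation[symmetric]) simp
    then show "(\<integral>\<^sup>+y. g (- (A *v y) + x) * h x \<partial>lborel) = (\<integral>\<^sup>+y. g (A *v y) * h x \<partial>lborel)"
      by (simp add: matrix_vector_right_distrib AA' even)
  qed
  also have "\<dots> = (\<integral>\<^sup>+x. h x \<partial>lborel) * (\<integral>\<^sup>+y. g (A *v y) \<partial>lborel)"
    by (simp add: nn_integral_cmult nn_integral_multc mult.commute)
  finally show ?thesis .
qed

text \<open>Calibration with the indicator of the unit ball, which \<open>U\<close> maps to itself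
  and whose volume is neither 0 nor infinite.\<close>

lemma nn_integral_orthogonal:
  fixes U :: "real^'n^'n" and h :: "real^'n \<Rightarrow> ennreal"
  assumes U: "orthogonal_matrix U" and [measurable]: "h \<in> borel_measurable borel"
  shows "(\<integral>\<^sup>+y. h (U *v y) \<partial>lborel) = (\<integral>\<^sup>+x. h x \<partial>lborel)"
proof -
  define m where "m = emeasure lborel (cball (0::real^'n) 1)"
  have "m = ennreal (unit_ball_vol CARD('n))"
    unfolding m_def by (subst emeasure_cball) auto
  then have m: "m \<noteq> 0" "m \<noteq> \<infinity>"
    using unit_ball_vol_pos[of "real CARD('n)"] by (auto simp del: unit_ball_vol_pos)
  have inv: "invertible U"
    using U unfolding orthogonal_matrix_def invertible_def by blast
  have "(\<integral>\<^sup>+x. indicator (cball (0::real^'n) 1) x \<partial>lborel) * (\<integral>\<^sup>+y. h (U *v y) \<partial>lborel) =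
    (\<integral>\<^sup>+x. h x \<partial>lborel) * (\<integral>\<^sup>+y. indicator (cball 0 1) (U *v y) \<partial>lborel)"
    by (rule nn_integral_linear_calibrate[OF inv]) (auto simp: indicator_def)
  moreover have "indicator (cball 0 1) (U *v y) = (indicator (cball 0 1) y :: ennreal)" for y
    by (simp add: indicator_def norm_orthogonal_matrix_vector[OF U])
  ultimately show ?thesis
    using m by (simp add: m_def[symmetric] mult.commute[of _ m] ennreal_mult_cancel_left)
qed

text \<open>Calibration with the cube [-1, 1]^n: its preimage under a diagonal matrix is a box,
  whose volume is explicit.\<close>

lemma nn_integral_diagonal:
  fixes D :: "real^'n^'n" and h :: "real^'n \<Rightarrow> ennreal"
  assumes off: "\<And>i j. i \<noteq> j \<Longrightarrow> D $ i $ j = 0" and pos: "\<And>i. D $ i $ i > 0"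
    and [measurable]: "h \<in> borel_measurable borel"
  shows "(\<integral>\<^sup>+y. h (D *v y) \<partial>lborel) = ennreal (1 / \<bar>det D\<bar>) * (\<integral>\<^sup>+x. h x \<partial>lborel)"
proof -
  have detD: "det D = (\<Prod>i\<in>UNIV. D $ i $ i)" using off by (rule det_diagonal)
  have detpos: "det D > 0" unfolding detD using pos by (simp add: prod_pos)
  then have inv: "invertible D" by (simp add: invertible_det_nz)
  have Dv: "(D *v y) $ i = D $ i $ i * y $ i" for y i
  proof -
    have "(D *v y) $ i = (\<Sum>j\<in>UNIV. if j = i then D $ i $ i * y $ i else 0)"
      unfolding matrix_vector_mult_def vec_lambda_beta using off[of i] by (intro sum.cong) auto
    then show ?thesis by simp
  qed
  have box: "(\<integral>\<^sup>+x. indicator (cbox (-a) a) x \<partial>lborel) = ennreal (\<Prod>i\<in>UNIV. 2 * a $ i)"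
    if a: "\<And>i. a $ i > 0" for a :: "real^'n"
  proof -
    have "a $ i \<ge> - a $ i" for i using a[of i] by simp
    then have "cbox (-a) a \<noteq> {}" unfolding interval_ne_empty_cart by simp
    then have "measure lborel (cbox (-a) a) = (\<Prod>i\<in>UNIV. 2 * a $ i)"
      by (simp add: content_cbox_cart)
    moreover have "emeasure lborel (cbox (-a) a) = ennreal (measure lborel (cbox (-a) a))"
      using emeasure_lborel_cbox_finite[of "-a" a] by (intro emeasure_eq_ennreal_measure) auto
    ultimately show ?thesis by simp
  qed
  define a :: "real^'n" where "a = (\<chi> i. 1 / D $ i $ i)"
  have a: "a $ i > 0" for i using pos by (simp add: a_def)
  have ind: "indicator (cbox (-1) 1) (D *v y) = (indicator (cbox (-a) a) y :: ennreal)" for y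
  proof -
    have "(-1 \<le> D $ i $ i * y $ i \<and> D $ i $ i * y $ i \<le> 1) = (- a $ i \<le> y $ i \<and> y $ i \<le> a $ i)" for i
      using pos[of i] by (simp add: a_def field_simps)
    then show ?thesis by (auto simp: indicator_def mem_box_cart Dv)
  qed
  have "(\<integral>\<^sup>+x. indicator (cbox (-1) (1::real^'n)) x \<partial>lborel) * (\<integral>\<^sup>+y. h (D *v y) \<partial>lborel) =
    (\<integral>\<^sup>+x. h x \<partial>lborel) * (\<integral>\<^sup>+y. indicator (cbox (-1) 1) (D *v y) \<partial>lborel)"
    by (rule nn_integral_linear_calibrate[OF inv])
       (auto simp: indicator_def mem_box_cart minus_le_iff intro: le_imp_neg_le)
  then have "ennreal (2 ^ CARD('n)) * (\<integral>\<^sup>+y. h (D *v y) \<partial>lborel)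
      = (\<integral>\<^sup>+x. h x \<partial>lborel) * ennreal (\<Prod>i\<in>UNIV. 2 * a $ i)"
    using box[of 1] box[of a, OF a] by (simp add: ind)
  also have "(\<Prod>i\<in>UNIV. 2 * a $ i) = 2 ^ CARD('n) * (1 / \<bar>det D\<bar>)"
    using detpos by (simp add: prod.distrib a_def prod_dividef detD)
  also have "ennreal \<dots> = ennreal (2 ^ CARD('n)) * ennreal (1 / \<bar>det D\<bar>)"
    by (rule ennreal_mult) auto
  finally have "ennreal (2 ^ CARD('n)) * (\<integral>\<^sup>+y. h (D *v y) \<partial>lborel) =
      ennreal (2 ^ CARD('n)) * (ennreal (1 / \<bar>det D\<bar>) * (\<integral>\<^sup>+x. h x \<partial>lborel))"
    by (simp add: ac_simps)
  then show ?thesis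
    by (subst (asm) ennreal_mult_cancel_left) auto
qed

lemma nn_integral_affine:
  fixes A :: "real^'n^'n" and h :: "real^'n \<Rightarrow> ennreal"
  assumes A: "invertible A" and h[measurable]: "h \<in> borel_measurable borel"
  shows "(\<integral>\<^sup>+y. h (A *v y + b) \<partial>lborel) = ennreal (1 / \<bar>det A\<bar>) * (\<integral>\<^sup>+x. h x \<partial>lborel)"
proof -
  have lin: "(\<integral>\<^sup>+y. h (A *v y) \<partial>lborel) = ennreal (1 / \<bar>det A\<bar>) * (\<integral>\<^sup>+x. h x \<partial>lborel)"
    if [measurable]: "h \<in> borel_measurable borel" for h :: "real^'n \<Rightarrow> ennreal"
  proof -
    obtain U V D where UV: "orthogonal_matrix U" "orthogonal_matrix V" and D: "U ** A ** V = D"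
      and off: "\<And>i j. i \<noteq> j \<Longrightarrow> D $ i $ j = 0" and nn: "\<And>i. D $ i $ i \<ge> 0"
      using singular_value_decomposition[of A] by blast
    have "\<bar>det D\<bar> = \<bar>det U\<bar> * \<bar>det A\<bar> * \<bar>det V\<bar>" by (simp add: det_mul abs_mult flip: D)
    then have absD: "\<bar>det D\<bar> = \<bar>det A\<bar>" by (simp add: abs_det_orthogonal UV)
    with A have "det D \<noteq> 0" by (auto simp: invertible_det_nz)
    moreover have "det D = (\<Prod>i\<in>UNIV. D $ i $ i)" using off by (rule det_diagonal)
    ultimately have pos: "D $ i $ i > 0" for i using nn[of i] by (auto simp: less_le)
    have U: "transpose U ** U = mat 1" using UV by (simp add: orthogonal_matrix_def)
    have "(\<integral>\<^sup>+y. h (A *v y) \<partial>lborel) = (\<integral>\<^sup>+y. h (A *v (V *v y)) \<partial>lborel)"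
      by (rule nn_integral_orthogonal[OF UV(2), symmetric]) measurable
    also have "\<dots> = (\<integral>\<^sup>+y. h (transpose U *v (D *v y)) \<partial>lborel)"
      by (simp add: matrix_vector_mul_assoc matrix_mul_assoc U flip: D)
    also have "\<dots> = ennreal (1 / \<bar>det A\<bar>) * (\<integral>\<^sup>+y. h (transpose U *v y) \<partial>lborel)"
      unfolding absD[symmetric] by (rule nn_integral_diagonal[OF off pos]) measurable
    also have "(\<integral>\<^sup>+y. h (transpose U *v y) \<partial>lborel) = (\<integral>\<^sup>+y. h y \<partial>lborel)"
      using UV by (intro nn_integral_orthogonal) auto
    finally show ?thesis .
  qed
  have "(\<integral>\<^sup>+y. h (A *v y + b) \<partial>lborel) = (\<integral>\<^sup>+y. h (b + A *v y) \<partial>lborel)"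
    by (simp add: add.commute)
  also have "\<dots> = ennreal (1 / \<bar>det A\<bar>) * (\<integral>\<^sup>+x. h (b + x) \<partial>lborel)"
    by (rule lin) simp
  also have "(\<integral>\<^sup>+x. h (b + x) \<partial>lborel) = (\<integral>\<^sup>+x. h x \<partial>lborel)"
    by (rule nn_integral_lborel_translation) simp
  finally show ?thesis .
qed

section \<open>Integrability of exponentials of the norm\<close>

lemma nn_integral_exp_abs_finite:
  assumes "c > 0"
  shows "(\<integral>\<^sup>+x. ennreal (exp (- c * \<bar>x\<bar>)) \<partial>lborel) < \<infinity>"
proof -
  have half: "(\<integral>\<^sup>+x. ennreal (exp (- c * x)) * indicator {0..} x \<partial>lborel) = ennreal (0 - (- exp (- c * 0) / c))"
  proof (rule nn_integral_FTC_atLeast)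
    show "((\<lambda>x. - exp (- c * x) / c) \<longlongrightarrow> 0) at_top"
    proof -
      have "LIM x at_top. - c * x :> at_bot"
        using assms by (intro filterlim_tendsto_neg_mult_at_bot[OF tendsto_const]) (auto simp: filterlim_ident)
      then have "((\<lambda>x. exp (- c * x)) \<longlongrightarrow> 0) at_top"
        by (rule filterlim_compose[OF exp_at_bot])
      then show ?thesis using tendsto_divide[OF tendsto_minus tendsto_const, of "\<lambda>x. exp (- c * x)" 0 at_top c] assms by simp
    qed
  qed (use assms in \<open>auto intro!: derivative_eq_intros\<close>)
  moreover have "(\<integral>\<^sup>+x. ennreal (exp (- c * x)) * indicator {0..} x \<partial>lborel) =
      (\<integral>\<^sup>+x. ennreal (exp (- c * (- x))) * indicator {0..} (- x) \<partial>lborel)"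
    using nn_integral_real_affine[of "\<lambda>x. ennreal (exp (- c * x)) * indicator {0..} x" "-1" 0] by simp
  ultimately have refl: "(\<integral>\<^sup>+x. ennreal (exp (- c * (- x))) * indicator {0..} (- x) \<partial>lborel) < \<infinity>"
    by (metis ennreal_less_top infinity_ennreal_def)
  have "(\<integral>\<^sup>+x. ennreal (exp (- c * \<bar>x\<bar>)) \<partial>lborel) \<le>
    (\<integral>\<^sup>+x. ennreal (exp (- c * x)) * indicator {0..} x + ennreal (exp (- c * (- x))) * indicator {0..} (- x) \<partial>lborel)"
    by (intro nn_integral_mono) (auto simp: indicator_def abs_if)
  also have "\<dots> < \<infinity>"
    by (subst nn_integral_add) (use half refl in \<open>auto simp: ennreal_add_less_top\<close>)
  finally show ?thesis .
qed

text \<open>Each coordinate is at most the norm, so with e = c / d the sum of e times the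
  coordinates is at most c times the norm. The integrand is thus below a product of one-dimensional
  ones.\<close>

lemma nn_integral_exp_norm_finite:
  assumes "c > 0"
  shows "(\<integral>\<^sup>+x. ennreal (exp (- c * norm x)) \<partial>(lborel :: 'a::euclidean_space measure)) < \<infinity>"
proof -
  define e where "e = c / DIM('a)"
  have e: "e > 0" using assms by (simp add: e_def)
  have "exp (- c * norm x) \<le> (\<Prod>b\<in>Basis. exp (- e * \<bar>x \<bullet> b\<bar>))" for x :: 'a
  proof -
    have "(\<Sum>b\<in>Basis. e * \<bar>x \<bullet> b\<bar>) \<le> (\<Sum>b\<in>(Basis::'a set). e * norm x)"
      using e by (intro sum_mono mult_left_mono Basis_le_norm) auto
    also have "\<dots> = c * norm x" by (simp add: e_def)
    finally show ?thesis by (simp add: exp_sum[symmetric] sum_negf)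
  qed
  then have "(\<integral>\<^sup>+x. ennreal (exp (- c * norm x)) \<partial>(lborel :: 'a measure)) \<le>
      (\<integral>\<^sup>+x. (\<Prod>b\<in>Basis. ennreal (exp (- e * \<bar>x \<bullet> b\<bar>))) \<partial>(lborel :: 'a measure))"
    by (intro nn_integral_mono) (simp only: prod_ennreal[OF exp_ge_zero] ennreal_leI)
  also have "\<dots> = (\<Prod>b\<in>(Basis::'a set). (\<integral>\<^sup>+x. ennreal (exp (- e * \<bar>x\<bar>)) \<partial>lborel))"
    by (rule nn_integral_lborel_prod) auto
  also have "\<dots> < \<infinity>"
    using nn_integral_exp_abs_finite[OF e] by (simp add: power_less_top_ennreal)
  finally show ?thesis .
qed

section \<open>Profiles and ellipsoidal functions\<close>

text \<open>Monotonicity of the derivative is asked only on the half-line where norms live. It gives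
  strict convexity there and, with \<open>deriv_zero\<close>, strict growth. The instances are
  \<open>psi_scaled s\<close> for s > 0 and t^2; the profile t of s = 0 violates
  \<open>deriv_zero\<close>.\<close>

locale profile =
  fixes \<psi> \<psi>' :: "real \<Rightarrow> real"
  assumes has_deriv: "(\<psi> has_real_derivative \<psi>' t) (at t)"
    and deriv_strict_mono: "0 \<le> a \<Longrightarrow> a < b \<Longrightarrow> \<psi>' a < \<psi>' b"
    and zero [simp]: "\<psi> 0 = 0"
    and deriv_zero: "\<psi>' 0 = 0"
begin

lemma isCont_profile: "isCont \<psi> t"
  using has_deriv by (rule DERIV_isCont)

lemma continuous_profile [continuous_intros]:
  "continuous_on S g \<Longrightarrow> continuous_on S (\<lambda>x. \<psi> (g x))"
  by (rule continuous_on_compose2[of UNIV \<psi>]) (auto intro: continuous_at_imp_continuous_on isCont_profile)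

lemma measurable_profile [measurable]: "\<psi> \<in> borel_measurable borel"
  by (intro borel_measurable_continuous_onI continuous_at_imp_continuous_on) (auto intro: isCont_profile)

lemma strict_mono: assumes "0 \<le> a" "a < b" shows "\<psi> a < \<psi> b"
proof -
  obtain z where "a < z" "z < b" "\<psi> b - \<psi> a = (b - a) * \<psi>' z"
    using MVT2[OF assms(2), of \<psi> \<psi>'] has_deriv by blast
  moreover from this assms have "(b - a) * \<psi>' z > 0"
    using deriv_strict_mono[of 0 z] deriv_zero by (intro mult_pos_pos) auto
  ultimately show ?thesis by linarith
qed

lemma mono: "0 \<le> a \<Longrightarrow> a \<le> b \<Longrightarrow> \<psi> a \<le> \<psi> b"
  using strict_mono[of a b] by (cases "a = b") auto

lemma nonneg: "0 \<le> t \<Longrightarrow> 0 \<le> \<psi> t"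
  using mono[of 0 t] by simp

lemma one_pos: "\<psi> 1 > 0"
  using strict_mono[of 0 1] by simp

lemma midpoint_less:
  assumes "0 \<le> a" "a < b" shows "\<psi> ((a + b) / 2) < (\<psi> a + \<psi> b) / 2"
proof -
  let ?m = "(a + b) / 2"
  have "a < ?m" "?m < b" using assms by auto
  then obtain y z where "a < y" "y < ?m" "\<psi> ?m - \<psi> a = (?m - a) * \<psi>' y"
    and "?m < z" "z < b" "\<psi> b - \<psi> ?m = (b - ?m) * \<psi>' z"
    using MVT2[of a ?m \<psi> \<psi>'] MVT2[of ?m b \<psi> \<psi>'] has_deriv by metis
  moreover have "\<psi>' y < \<psi>' z" using calculation assms by (intro deriv_strict_mono) auto
  then have "(b - a) / 2 * \<psi>' y < (b - a) / 2 * \<psi>' z" using assms by simp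
  ultimately show ?thesis by (simp add: field_simps)
qed

lemma convex: "convex_on {0..} \<psi>"
  by (rule convex_on_realI[of _ _ \<psi>']) (auto intro: has_deriv less_imp_le deriv_strict_mono simp: le_less)

lemma scale_le: "0 \<le> t \<Longrightarrow> 0 \<le> c \<Longrightarrow> c \<le> 1 \<Longrightarrow> \<psi> (c * t) \<le> c * \<psi> t"
  using convex_onD[OF convex, of c 0 t] by simp

lemma linear_lower_bound: assumes "0 \<le> t" shows "\<psi> 1 * (t - 1) \<le> \<psi> t"
proof (cases "t \<le> 1")
  case True
  then have "\<psi> 1 * (t - 1) \<le> 0" using one_pos by (intro mult_nonneg_nonpos) auto
  with nonneg[OF assms] show ?thesis by linarith
next
  case False
  with scale_le[of t "1/t"] one_pos show ?thesis by (simp add: field_simps)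
qed

text \<open>Strictness has two sources. For vectors of equal norm it comes from the Euclidean norm,
  whose triangle inequality is strict here; for different norms it comes from strict convexity of
  the profile.\<close>

lemma midpoint_norm_less:
  fixes u v :: "'b::real_inner"
  assumes "u \<noteq> v"
  shows "\<psi> (norm ((1/2) *\<^sub>R (u + v))) < (\<psi> (norm u) + \<psi> (norm v)) / 2"
proof (cases "norm u = norm v")
  case True
  have "norm ((1/2) *\<^sub>R (u + v)) < norm u"
  proof -
    have "norm (u + v) \<noteq> norm u + norm v"
      using True assms norm_triangle_eq[of u v] by auto
    with norm_triangle_ineq[of u v] True show ?thesis by simp
  qed
  from strict_mono[OF _ this] True show ?thesis by simp
next
  case False
  have "norm ((1/2) *\<^sub>R (u + v)) \<le> (norm u + norm v) / 2"
    using norm_triangle_ineq[of u v] by simp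
  then have "\<psi> (norm ((1/2) *\<^sub>R (u + v))) \<le> \<psi> ((norm u + norm v) / 2)" by (intro mono) auto
  also have "\<dots> < (\<psi> (norm u) + \<psi> (norm v)) / 2"
    using False midpoint_less[of "norm u" "norm v"] midpoint_less[of "norm v" "norm u"]
    by (cases "norm u < norm v") (auto simp: add.commute)
  finally show ?thesis .
qed

lemma midpoint_norm_le:
  fixes u v :: "'b::real_inner"
  shows "\<psi> (norm ((1/2) *\<^sub>R (u + v))) \<le> (\<psi> (norm u) + \<psi> (norm v)) / 2"
proof (cases "u = v")
  case True
  then have "(1/2) *\<^sub>R (u + v) = u" by (simp flip: scaleR_2)
  with True show ?thesis by simp
qed (use midpoint_norm_less less_imp_le in blast)

text \<open>The midpoint gap of \<open>\<psi>\<close> may vanish at infinity, but there shrinking the argument gains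
  \<open>\<eta> \<psi>\<close>, which is at least \<open>2 d \<eta>\<close>.\<close>

lemma uniform_midpoint_gap:
  fixes v :: "'b::euclidean_space"
  assumes v: "v \<noteq> 0" and d: "d > 0"
  obtains \<eta> where "0 < \<eta>" "\<eta> \<le> 1/4"
    "\<And>y. \<psi> ((1 - \<eta>) * norm y) + 2 * d * \<eta> \<le> (\<psi> (norm (y + v)) + \<psi> (norm (y - v))) / 2"
proof -
  \<comment> \<open>From \<open>R\<close> on the line \<open>\<psi> 1 * (t - 1)\<close> below the
    profile is at least 2 d.\<close>
  define R where "R = 1 + 2 * d / \<psi> 1"
  have R: "\<psi> t \<ge> 2 * d" if "t \<ge> R" for t
  proof -
    have "0 < R" using d one_pos by (simp add: R_def add_pos_pos)
    then have "\<psi> 1 * (t - 1) \<le> \<psi> t" using that by (intro linear_lower_bound) auto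
    moreover have "\<psi> 1 * (t - 1) \<ge> \<psi> 1 * (R - 1)" using that one_pos by simp
    moreover have "\<psi> 1 * (R - 1) = 2 * d" using one_pos by (simp add: R_def)
    ultimately show ?thesis by linarith
  qed
  define g where "g y = (\<psi> (norm (y + v)) + \<psi> (norm (y - v))) / 2 - \<psi> (norm y)" for y
  have avg: "(1/2) *\<^sub>R ((y + v) + (y - v)) = y" for y
    by (simp flip: scaleR_2)
  have "y + v \<noteq> y - v" for y
  proof
    assume "y + v = y - v"
    then have "v + v = 0" by (simp add: algebra_simps)
    then have "2 *\<^sub>R v = 0" by (simp only: scaleR_2)
    with v show False by simp
  qed
  then have gpos: "g y > 0" for y
    using midpoint_norm_less[of "y + v" "y - v"] by (simp add: g_def avg)
  have R0: "R > 0" using d one_pos by (simp add: R_def add_pos_pos)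
  have "continuous_on (cball 0 R) g"
    unfolding g_def by (intro continuous_intros) auto
  then obtain y0 where y0: "\<And>y. y \<in> cball 0 R \<Longrightarrow> g y0 \<le> g y"
    using continuous_attains_inf[OF compact_cball, of 0 R g] R0 by (metis cball_eq_empty not_less_iff_gr_or_eq)
  \<comment> \<open>The cap 1/4 is the range of \<open>exp_neg_double_less\<close>, where \<eta>
    will be used. The other term keeps 2 d \<eta> below the least gap on the ball.\<close>
  define \<eta> where "\<eta> = min (1/4) (g y0 / (2 * d))"
  have \<eta>: "0 < \<eta>" "\<eta> \<le> 1/4" "2 * d * \<eta> \<le> g y0"
    using gpos[of y0] d by (auto simp: \<eta>_def min_def field_simps)
  moreover have "\<psi> ((1 - \<eta>) * norm y) + 2 * d * \<eta> \<le> (\<psi> (norm (y + v)) + \<psi> (norm (y - v))) / 2" for y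
  proof (cases "norm y \<le> R")
    case True
    have "\<psi> ((1 - \<eta>) * norm y) \<le> \<psi> (norm y)"
      using \<eta> by (intro mono) (auto simp: mult_left_le_one_le)
    moreover have "2 * d * \<eta> \<le> g y" using y0[of y] True \<eta>(3) by auto
    ultimately show ?thesis unfolding g_def by linarith
  next
    case False
    have "\<psi> ((1 - \<eta>) * norm y) \<le> (1 - \<eta>) * \<psi> (norm y)"
      using \<eta> by (intro scale_le) auto
    moreover have "\<eta> * (2 * d) \<le> \<eta> * \<psi> (norm y)" using R[of "norm y"] False \<eta> by (intro mult_left_mono) auto
    ultimately show ?thesis using gpos[of y] unfolding g_def by (simp add: algebra_simps)
  qed
  ultimately show thesis using that by blast
qed

end

text \<open>The offset b = - A a replaces the centre a: the vector A x + b is linear in (A, b), so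
  two majorants can be averaged through their parameters.\<close>

definition ell :: "(real \<Rightarrow> real) \<Rightarrow> real \<Rightarrow> real^'n^'n \<Rightarrow> real^'n \<Rightarrow> real^'n \<Rightarrow> real" where
  "ell \<psi> \<alpha> A b x = \<alpha> * exp (- \<psi> (norm (A *v x + b)))"

lemma ellipsoidal_class_eq:
  "ellipsoidal_class \<psi> = {ell \<psi> \<alpha> (A :: real^'n^'n) b | \<alpha> A b. \<alpha> > 0 \<and> invertible A}"
proof (intro equalityI subsetI)
  fix l :: "real^'n \<Rightarrow> real" assume "l \<in> ellipsoidal_class \<psi>"
  then obtain \<alpha> a and A :: "real^'n^'n" where "l = (\<lambda>x. \<alpha> * exp (- \<psi> (norm (A *v (x - a)))))" "invertible A" "\<alpha> > 0"
    by (auto simp: ellipsoidal_class_def)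
  moreover from this have "l = ell \<psi> \<alpha> A (- (A *v a))"
    by (auto simp: ell_def matrix_vector_mult_diff_distrib)
  ultimately show "l \<in> {ell \<psi> \<alpha> (A :: real^'n^'n) b | \<alpha> A b. \<alpha> > 0 \<and> invertible A}" by blast
next
  fix l assume "l \<in> {ell \<psi> \<alpha> (A :: real^'n^'n) b | \<alpha> A b. \<alpha> > 0 \<and> invertible A}"
  then obtain \<alpha> b and A :: "real^'n^'n" where l: "l = ell \<psi> \<alpha> A b" "invertible A" "\<alpha> > 0" by blast
  then obtain A' where "A ** A' = mat 1" by (auto simp: invertible_def)
  then have "A *v (x - - (A' *v b)) = A *v x + b" for x
    by (simp add: matrix_vector_right_distrib matrix_vector_mul_assoc)
  then have "l = (\<lambda>x. \<alpha> * exp (- \<psi> (norm (A *v (x - - (A' *v b))))))"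
    using l by (auto simp: ell_def)
  with l show "l \<in> ellipsoidal_class \<psi>" unfolding ellipsoidal_class_def by blast
qed

lemma det_scaleR:
  fixes A :: "real^'n^'n" shows "det (c *\<^sub>R A) = c ^ CARD('n) * det A"
proof -
  have "c *\<^sub>R A = (c *\<^sub>R mat 1) ** A" by (simp add: scalar_matrix_assoc[symmetric])
  moreover have "det (c *\<^sub>R mat 1 :: real^'n^'n) = c ^ CARD('n)"
    by (subst det_diagonal) (auto simp: mat_def)
  ultimately show ?thesis by (simp add: det_mul)
qed

lemma ellipsoidal_class_rescale_subset:
  assumes c: "c > 0"
  shows "(ellipsoidal_class (\<lambda>t. \<psi> (c * t)) :: (real^'n \<Rightarrow> real) set) \<subseteq> ellipsoidal_class \<psi>"
proof
  fix l :: "real^'n \<Rightarrow> real"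
  assume "l \<in> ellipsoidal_class (\<lambda>t. \<psi> (c * t))"
  then obtain \<alpha> b and A :: "real^'n^'n" where l: "l = ell (\<lambda>t. \<psi> (c * t)) \<alpha> A b" "invertible A" "\<alpha> > 0"
    unfolding ellipsoidal_class_eq by blast
  have "det (c *\<^sub>R A) \<noteq> 0"
    using l c by (simp add: det_scaleR invertible_det_nz)
  moreover have "norm ((c *\<^sub>R A) *v x + c *\<^sub>R b) = c * norm (A *v x + b)" for x
  proof -
    have "(c *\<^sub>R A) *v x + c *\<^sub>R b = c *\<^sub>R (A *v x + b)"
      by (simp add: scaleR_matrix_vector_assoc[symmetric] scaleR_add_right)
    then show ?thesis using c by simp
  qed
  then have "l = ell \<psi> \<alpha> (c *\<^sub>R A) (c *\<^sub>R b)" by (auto simp: l ell_def)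
  ultimately show "l \<in> ellipsoidal_class \<psi>"
    unfolding ellipsoidal_class_eq using l(3) by (auto simp: invertible_det_nz)
qed

lemma ellipsoidal_class_rescale:
  assumes "c > 0"
  shows "(ellipsoidal_class (\<lambda>t. \<psi> (c * t)) :: (real^'n \<Rightarrow> real) set) = ellipsoidal_class \<psi>"
proof
  show "ellipsoidal_class \<psi> \<subseteq> (ellipsoidal_class (\<lambda>t. \<psi> (c * t)) :: (real^'n \<Rightarrow> real) set)"
    using ellipsoidal_class_rescale_subset[of "1 / c" "\<lambda>t. \<psi> (c * t)", where 'n='n] assms by simp
qed (rule ellipsoidal_class_rescale_subset[OF assms])

text \<open>Phrased through the parameters, so that limits concern real numbers and no integrals.
  Optimal parameters are not unique, since A and b may be multiplied by an orthogonal matrix; only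
  the function is.\<close>

definition optimal :: "(real \<Rightarrow> real) \<Rightarrow> (real^'n \<Rightarrow> real) \<Rightarrow> real \<Rightarrow> real^'n^'n \<Rightarrow> real^'n \<Rightarrow> bool" where
  "optimal \<psi> f \<alpha> A b \<longleftrightarrow> \<alpha> > 0 \<and> invertible A \<and> f \<le> ell \<psi> \<alpha> A b \<and>
    (\<forall>\<alpha>' A' b'. \<alpha>' > 0 \<longrightarrow> invertible A' \<longrightarrow> f \<le> ell \<psi> \<alpha>' A' b' \<longrightarrow> \<alpha> / \<bar>det A\<bar> \<le> \<alpha>' / \<bar>det A'\<bar>)"

context profile
begin

text \<open>The \<open>itself\<close> argument merely carries the dimension.\<close>

definition mass :: "'m::finite itself \<Rightarrow> ennreal" where
  "mass _ = (\<integral>\<^sup>+x. ennreal (exp (- \<psi> (norm (x :: real^'m)))) \<partial>lborel)"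

lemma mass_finite: "mass TYPE('m::finite) < \<infinity>"
proof -
  have "mass TYPE('m) \<le> (\<integral>\<^sup>+x. ennreal (exp (\<psi> 1)) * ennreal (exp (- \<psi> 1 * norm (x::real^'m))) \<partial>lborel)"
    unfolding mass_def
  proof (intro nn_integral_mono)
    fix x :: "real^'m"
    have "- \<psi> (norm x) \<le> \<psi> 1 + - \<psi> 1 * norm x"
      using linear_lower_bound[of "norm x"] by (simp add: algebra_simps)
    then show "ennreal (exp (- \<psi> (norm x))) \<le> ennreal (exp (\<psi> 1)) * ennreal (exp (- \<psi> 1 * norm x))"
      by (simp add: ennreal_mult[symmetric] exp_add[symmetric] ennreal_leI)
  qed
  also have "\<dots> < \<infinity>"
    using nn_integral_exp_norm_finite[OF one_pos, where 'a="real^'m"]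
    by (subst nn_integral_cmult) (auto simp: ennreal_mult_less_top)
  finally show ?thesis .
qed

lemma mass_pos: "mass TYPE('m::finite) > 0"
proof -
  have "0 < ennreal (exp (- \<psi> 1)) * emeasure lborel (cball (0::real^'m) 1)"
    using unit_ball_vol_pos[of "real CARD('m)"]
    by (subst emeasure_cball) (auto simp: ennreal_zero_less_mult_iff simp del: unit_ball_vol_pos)
  also have "\<dots> = (\<integral>\<^sup>+x. ennreal (exp (- \<psi> 1)) * indicator (cball (0::real^'m) 1) x \<partial>lborel)"
    by (rule nn_integral_cmult_indicator[symmetric]) simp
  also have "\<dots> \<le> mass TYPE('m)"
    unfolding mass_def by (intro nn_integral_mono) (auto simp: indicator_def intro!: ennreal_leI mono)
  finally show ?thesis .
qed

lemma nn_integral_ell: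
  fixes A :: "real^'m^'m"
  assumes "invertible A" "\<alpha> > 0"
  shows "(\<integral>\<^sup>+x. ennreal (ell \<psi> \<alpha> A b x) \<partial>lborel) = ennreal (\<alpha> / \<bar>det A\<bar>) * mass TYPE('m)"
proof -
  have "(\<integral>\<^sup>+x. ennreal (ell \<psi> \<alpha> A b x) \<partial>lborel) =
      (\<integral>\<^sup>+x. ennreal \<alpha> * ennreal (exp (- \<psi> (norm (A *v x + b)))) \<partial>lborel)"
    using assms(2) by (simp add: ell_def ennreal_mult)
  also have "\<dots> = ennreal \<alpha> * (\<integral>\<^sup>+x. ennreal (exp (- \<psi> (norm (A *v x + b)))) \<partial>lborel)"
    by (rule nn_integral_cmult) measurable
  also have "(\<integral>\<^sup>+x. ennreal (exp (- \<psi> (norm (A *v x + b)))) \<partial>lborel) = ennreal (1 / \<bar>det A\<bar>) * mass TYPE('m)"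
    unfolding mass_def by (rule nn_integral_affine[OF assms(1), of "\<lambda>x. ennreal (exp (- \<psi> (norm x)))"]) measurable
  finally show ?thesis
    using assms(2) by (simp add: mult.assoc[symmetric] ennreal_mult[symmetric])
qed

lemma solves_loewner_problem_iff:
  fixes f :: "real^'m \<Rightarrow> real"
  assumes "(ellipsoidal_class (psi s) :: (real^'m \<Rightarrow> real) set) = ellipsoidal_class \<psi>"
  shows "solves_loewner_problem s f l \<longleftrightarrow> (\<exists>\<alpha> A b. optimal \<psi> f \<alpha> A b \<and> l = ell \<psi> \<alpha> A b)"
proof -
  have le: "(\<integral>\<^sup>+x. ennreal (ell \<psi> \<alpha> A b x) \<partial>lborel) \<le> (\<integral>\<^sup>+x. ennreal (ell \<psi> \<alpha>' A' b' x) \<partial>lborel)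
     \<longleftrightarrow> \<alpha> / \<bar>det A\<bar> \<le> \<alpha>' / \<bar>det A'\<bar>"
    if "invertible A" "\<alpha> > 0" "invertible A'" "\<alpha>' > 0" for \<alpha> b \<alpha>' b' and A A' :: "real^'m^'m"
    using that mass_finite[where 'm='m] mass_pos[where 'm='m]
    by (simp add: nn_integral_ell mult.commute[of _ "mass _"] ennreal_mult_le_mult_iff)
  show ?thesis
  proof
    assume "solves_loewner_problem s f l"
    then obtain \<alpha> A b where "l = ell \<psi> \<alpha> A b" "\<alpha> > 0" "invertible A" "f \<le> l"
      and min: "\<And>l'. l' \<in> ellipsoidal_class \<psi> \<Longrightarrow> f \<le> l' \<Longrightarrow>
        (\<integral>\<^sup>+x. ennreal (l x) \<partial>lborel) \<le> (\<integral>\<^sup>+x. ennreal (l' x) \<partial>lborel)"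
      unfolding solves_loewner_problem_def assms by (auto simp: ellipsoidal_class_eq[of \<psi>])
    moreover have "\<alpha> / \<bar>det A\<bar> \<le> \<alpha>' / \<bar>det A'\<bar>" if "\<alpha>' > 0" "invertible A'" "f \<le> ell \<psi> \<alpha>' A' b'" for \<alpha>' A' b'
    proof -
      have "ell \<psi> \<alpha>' A' b' \<in> ellipsoidal_class \<psi>" using that unfolding ellipsoidal_class_eq by blast
      from min[OF this that(3)] show ?thesis using that calculation by (simp add: le)
    qed
    ultimately show "\<exists>\<alpha> A b. optimal \<psi> f \<alpha> A b \<and> l = ell \<psi> \<alpha> A b"
      unfolding optimal_def by blast
  next
    assume "\<exists>\<alpha> A b. optimal \<psi> f \<alpha> A b \<and> l = ell \<psi> \<alpha> A b"
    then obtain \<alpha> A b where o: "optimal \<psi> f \<alpha> A b" "l = ell \<psi> \<alpha> A b" by blast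
    have "l \<in> ellipsoidal_class \<psi>" using o unfolding ellipsoidal_class_eq optimal_def by blast
    moreover have "(\<integral>\<^sup>+x. ennreal (l x) \<partial>lborel) \<le> (\<integral>\<^sup>+x. ennreal (l' x) \<partial>lborel)"
      if l': "l' \<in> ellipsoidal_class \<psi>" "f \<le> l'" for l'
    proof -
      obtain \<alpha>' A' b' where "l' = ell \<psi> \<alpha>' A' b'" "\<alpha>' > 0" "invertible A'"
        using l'(1) unfolding ellipsoidal_class_eq by blast
      with l'(2) o show ?thesis unfolding optimal_def by (simp only: le)
    qed
    ultimately show "solves_loewner_problem s f l"
      using o unfolding solves_loewner_problem_def assms optimal_def by blast
  qed
qed

end

section \<open>Uniqueness and existence of minimisers\<close>

text \<open>Shrinking A by the factor 1 - x divides the ratio \<alpha> / |det A| by (1 - x)^n, while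
  the amplitude is lowered by exp (- 2 n x). The estimate says that the net effect is a
  gain.\<close>

lemma exp_neg_double_less:
  fixes x :: real assumes "0 < x" "x \<le> 1/4" shows "exp (- (2 * x)) < 1 - x"
proof -
  have "1 < (1 - x) * (1 + 2 * x)"
  proof -
    have "x * x \<le> 1/4 * x" using assms by (intro mult_right_mono) auto
    then show ?thesis using assms by (simp add: algebra_simps)
  qed
  also have "\<dots> \<le> (1 - x) * exp (2 * x)"
    using assms exp_ge_add_one_self[of "2 * x"] by (intro mult_left_mono) auto
  finally show ?thesis by (simp add: exp_minus field_simps)
qed

lemma ell_orthogonal:
  assumes "orthogonal_matrix W"
  shows "ell \<psi> \<alpha> (W ** A) (W *v b) = ell \<psi> \<alpha> A b"
  by (auto simp: ell_def norm_orthogonal_matrix_vector[OF assms]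
      simp flip: matrix_vector_mul_assoc matrix_vector_right_distrib)

lemma optimal_ratio_eq:
  assumes "optimal \<psi> f \<alpha>1 A1 b1" "optimal \<psi> f \<alpha>2 A2 b2"
  shows "\<alpha>1 / \<bar>det A1\<bar> = \<alpha>2 / \<bar>det A2\<bar>"
  using assms unfolding optimal_def by (intro antisym) blast+

text \<open>Averaging the offsets alone leaves the ratio unchanged. The gap that it creates, taken
  with d = n, allows shrinking A by 1 - \<eta> and \<alpha> by exp (- 2 n \<eta>) at the same time.
  The ratio is then multiplied by (exp (- 2 \<eta>) / (1 - \<eta>))^n < 1, which contradicts
  optimality.\<close>

lemma (in profile) optimal_offset_unique:
  fixes A :: "real^'n^'n"
  assumes o: "optimal \<psi> f \<alpha> A b1" and f2: "f \<le> ell \<psi> \<alpha> A b2"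
  shows "b1 = b2"
proof (rule ccontr)
  assume ne: "b1 \<noteq> b2"
  have \<alpha>: "\<alpha> > 0" and A: "invertible A" and f1: "f \<le> ell \<psi> \<alpha> A b1" using o by (auto simp: optimal_def)
  define v where "v = (1/2) *\<^sub>R (b1 - b2)"
  define b where "b = (1/2) *\<^sub>R (b1 + b2)"
  have b12: "b1 = b + v" "b2 = b - v"
    by (simp_all add: b_def v_def vec_eq_iff field_simps)
  have v0: "v \<noteq> 0" using ne by (simp add: v_def)
  have card0: "real CARD('n) > 0" by simp
  obtain \<eta> where \<eta>: "0 < \<eta>" "\<eta> \<le> 1/4"
    and gap: "\<And>y::real^'n. \<psi> ((1 - \<eta>) * norm y) + 2 * real CARD('n) * \<eta> \<le> (\<psi> (norm (y + v)) + \<psi> (norm (y - v))) / 2"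
    by (rule uniform_midpoint_gap[OF v0 card0]) (rule that)
  define \<alpha>' where "\<alpha>' = \<alpha> * exp (- (2 * real CARD('n) * \<eta>))"
  have le: "f x \<le> ell \<psi> \<alpha>' ((1 - \<eta>) *\<^sub>R A) ((1 - \<eta>) *\<^sub>R b) x" for x
  proof -
    define y where "y = A *v x + b"
    have y12: "A *v x + b1 = y + v" "A *v x + b2 = y - v" by (simp_all add: y_def b12 add.assoc)
    have "(1 - \<eta>) *\<^sub>R A *v x + (1 - \<eta>) *\<^sub>R b = (1 - \<eta>) *\<^sub>R y"
      by (simp add: y_def scaleR_add_right scaleR_matrix_vector_assoc)
    then have n: "norm ((1 - \<eta>) *\<^sub>R A *v x + (1 - \<eta>) *\<^sub>R b) = (1 - \<eta>) * norm y" using \<eta> by simp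
    have "f x \<le> \<alpha> * exp (- \<psi> (norm (y + v)))" "f x \<le> \<alpha> * exp (- \<psi> (norm (y - v)))"
      using f1 f2 by (auto simp: le_fun_def ell_def y12 dest: spec[of _ x])
    then have "f x \<le> \<alpha> * exp (- max (\<psi> (norm (y + v))) (\<psi> (norm (y - v))))"
      by (auto simp: max_def)
    also have "\<dots> \<le> \<alpha> * exp (- (\<psi> ((1 - \<eta>) * norm y) + 2 * real CARD('n) * \<eta>))"
      using gap[of y] \<alpha> by (intro mult_left_mono) auto
    also have "\<dots> = ell \<psi> \<alpha>' ((1 - \<eta>) *\<^sub>R A) ((1 - \<eta>) *\<^sub>R b) x"
      by (simp add: ell_def n \<alpha>'_def exp_add[symmetric])
    finally show ?thesis .
  qed
  have det: "\<bar>det ((1 - \<eta>) *\<^sub>R A)\<bar> = (1 - \<eta>) ^ CARD('n) * \<bar>det A\<bar>"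
    using \<eta> by (simp add: det_scaleR abs_mult power_abs)
  have dA: "\<bar>det A\<bar> > 0" using A by (simp add: invertible_det_nz)
  have "invertible ((1 - \<eta>) *\<^sub>R A)" using A \<eta> by (simp add: invertible_det_nz det_scaleR)
  moreover have "\<alpha>' > 0" using \<alpha> by (simp add: \<alpha>'_def)
  ultimately have "\<alpha> / \<bar>det A\<bar> \<le> \<alpha>' / \<bar>det ((1 - \<eta>) *\<^sub>R A)\<bar>"
    using o le unfolding optimal_def le_fun_def by blast
  also have "\<dots> = \<alpha> / \<bar>det A\<bar> * (exp (- (2 * \<eta>)) / (1 - \<eta>)) ^ CARD('n)"
    unfolding det \<alpha>'_def by (simp add: power_divide exp_of_nat_mult[symmetric] mult_ac)
  finally have "\<alpha> / \<bar>det A\<bar> * 1 \<le> \<alpha> / \<bar>det A\<bar> * (exp (- (2 * \<eta>)) / (1 - \<eta>)) ^ CARD('n)" by simp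
  then have "1 \<le> (exp (- (2 * \<eta>)) / (1 - \<eta>)) ^ CARD('n)"
    using mult_le_cancel_left_pos[OF divide_pos_pos[OF \<alpha> dA]] by blast
  moreover have "(exp (- (2 * \<eta>)) / (1 - \<eta>)) ^ CARD('n) < 1"
    using exp_neg_double_less[OF \<eta>] \<eta> by (intro power_less_one_iff[THEN iffD2]) auto
  ultimately show False by simp
qed

lemma (in profile) optimal_unique:
  fixes A1 A2 :: "real^'n^'n"
  assumes o1: "optimal \<psi> f \<alpha>1 A1 b1" and o2: "optimal \<psi> f \<alpha>2 A2 b2"
  shows "ell \<psi> \<alpha>1 A1 b1 = ell \<psi> \<alpha>2 A2 b2"
proof -
  have 1: "\<alpha>1 > 0" "invertible A1" "f \<le> ell \<psi> \<alpha>1 A1 b1"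
    and 2: "\<alpha>2 > 0" "invertible A2" "f \<le> ell \<psi> \<alpha>2 A2 b2"
    using o1 o2 by (auto simp: optimal_def)
  have d: "\<bar>det A1\<bar> > 0" "\<bar>det A2\<bar> > 0" using 1 2 by (auto simp: invertible_det_nz)
  have ratio: "\<alpha>1 / \<bar>det A1\<bar> = \<alpha>2 / \<bar>det A2\<bar>" by (rule optimal_ratio_eq[OF o1 o2])
  obtain W where W: "orthogonal_matrix W"
    and alt: "A1 = W ** A2 \<or> sqrt (\<bar>det A1\<bar> * \<bar>det A2\<bar>) < \<bar>det ((1/2) *\<^sub>R (A1 + W ** A2))\<bar>"
    using det_mean_orthogonal[OF 1(2) 2(2)] by blast
  \<comment> \<open>\<open>W\<close> changes the parameters of the second majorant but not the
    function, so the average may be formed with W A2 and W b2.\<close>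
  have ell2: "ell \<psi> \<alpha>2 (W ** A2) (W *v b2) = ell \<psi> \<alpha>2 A2 b2" by (rule ell_orthogonal[OF W])
  show ?thesis
  proof (cases "A1 = W ** A2")
    case True
    then have "\<bar>det A1\<bar> = \<bar>det A2\<bar>" by (simp add: det_mul abs_mult abs_det_orthogonal[OF W])
    with ratio d have \<alpha>: "\<alpha>1 = \<alpha>2" by simp
    have "b1 = W *v b2"
      by (rule optimal_offset_unique[OF o1]) (use 2(3) ell2 True \<alpha> in simp)
    then show ?thesis using ell2 True \<alpha> by simp
  next
    case False
    define A where "A = (1/2) *\<^sub>R (A1 + W ** A2)"
    define b where "b = (1/2) *\<^sub>R (b1 + W *v b2)"
    define \<alpha> where "\<alpha> = sqrt (\<alpha>1 * \<alpha>2)"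
    have \<alpha>: "\<alpha> > 0" using 1 2 by (simp add: \<alpha>_def)
    have less: "sqrt (\<bar>det A1\<bar> * \<bar>det A2\<bar>) < \<bar>det A\<bar>" using alt False by (simp add: A_def)
    have sqpos: "sqrt (\<bar>det A1\<bar> * \<bar>det A2\<bar>) > 0" using d by simp
    have A: "invertible A" using less sqpos by (auto simp: invertible_det_nz)
    have "f x \<le> ell \<psi> \<alpha> A b x" for x
    proof -
      let ?u = "A1 *v x + b1" and ?v = "(W ** A2) *v x + W *v b2"
      let ?p = "ell \<psi> \<alpha>1 A1 b1 x" and ?q = "ell \<psi> \<alpha>2 A2 b2 x"
      have q: "?q = \<alpha>2 * exp (- \<psi> (norm ?v))" unfolding ell2[symmetric] ell_def ..
      have p: "?p = \<alpha>1 * exp (- \<psi> (norm ?u))" unfolding ell_def ..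
      have pos: "?p > 0" "?q > 0" using 1(1) 2(1) by (auto simp: ell_def)
      have avg: "A *v x + b = (1/2) *\<^sub>R (?u + ?v)"
        by (simp add: A_def b_def scaleR_add_right matrix_vector_mult_add_rdistrib flip: scaleR_matrix_vector_assoc)
      have "f x \<le> min ?p ?q" using 1(3) 2(3) by (simp add: le_fun_def)
      also have "\<dots> \<le> sqrt (?p * ?q)"
      proof (rule real_le_rsqrt)
        show "(min ?p ?q)\<^sup>2 \<le> ?p * ?q"
          using pos unfolding power2_eq_square by (intro mult_mono) auto
      qed
      also have "?p * ?q = (\<alpha>1 * \<alpha>2) * (exp (- ((\<psi> (norm ?u) + \<psi> (norm ?v)) / 2)))\<^sup>2"
      proof -
        have "2 * - ((s + t) / 2) = - s + - t" for s t :: real by argo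
        then show ?thesis unfolding p q exp_double[symmetric] by (simp only: exp_add mult_ac)
      qed
      also have "sqrt \<dots> = \<alpha> * exp (- ((\<psi> (norm ?u) + \<psi> (norm ?v)) / 2))"
        by (simp add: real_sqrt_mult \<alpha>_def)
      also have "\<dots> \<le> ell \<psi> \<alpha> A b x"
        unfolding ell_def avg using midpoint_norm_le[of ?u ?v] \<alpha> by (intro mult_left_mono) auto
      finally show ?thesis .
    qed
    \<comment> \<open>Both ratios are minimal, hence equal, and so equal to their geometric mean;
      the averaged majorant has a strictly smaller ratio.\<close>
    with o1 \<alpha> A have "\<alpha>1 / \<bar>det A1\<bar> \<le> \<alpha> / \<bar>det A\<bar>"
      unfolding optimal_def le_fun_def by blast
    also have "\<dots> < \<alpha> / sqrt (\<bar>det A1\<bar> * \<bar>det A2\<bar>)"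
      using less sqpos \<alpha> by (intro divide_strict_left_mono mult_pos_pos) linarith+
    also have "\<dots> = sqrt ((\<alpha>1 / \<bar>det A1\<bar>) * (\<alpha>2 / \<bar>det A2\<bar>))"
      by (simp add: \<alpha>_def real_sqrt_mult real_sqrt_divide)
    also have "\<dots> = \<alpha>1 / \<bar>det A1\<bar>"
      unfolding ratio[symmetric] real_sqrt_abs2 using 1 by (intro abs_of_nonneg) auto
    finally show ?thesis by simp
  qed
qed

section \<open>Compactness of the parameters and existence of minimisers\<close>

lemma abs_matrix_entry_le_norm:
  fixes A :: "real^'n^'m" shows "\<bar>A $ i $ j\<bar> \<le> norm (A *v axis j 1)"
proof -
  have "A $ i $ j = (A *v axis j 1) $ i" by (simp add: matrix_vector_mult_basis column_def)
  then show ?thesis using component_le_norm_cart by metis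
qed

lemma abs_det_le:
  fixes A :: "real^'n^'n"
  assumes "\<And>i j. \<bar>A $ i $ j\<bar> \<le> B"
  shows "\<bar>det A\<bar> \<le> fact CARD('n) * B ^ CARD('n)"
proof -
  have "\<bar>det A\<bar> \<le> (\<Sum>p | p permutes (UNIV :: 'n set). \<bar>of_int (sign p) * (\<Prod>i\<in>UNIV. A $ i $ p i)\<bar>)"
    unfolding det_def by (rule sum_abs)
  also have "\<dots> \<le> (\<Sum>p | p permutes (UNIV :: 'n set). B ^ CARD('n))"
  proof (rule sum_mono)
    fix p assume "p \<in> {p. p permutes (UNIV :: 'n set)}"
    have "\<bar>of_int (sign p) * (\<Prod>i\<in>UNIV. A $ i $ p i)\<bar> = (\<Prod>i\<in>UNIV. \<bar>A $ i $ p i\<bar>)"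
      by (simp add: abs_mult abs_prod sign_def)
    also have "\<dots> \<le> (\<Prod>i\<in>(UNIV::'n set). B)"
      using assms by (intro prod_mono) auto
    finally show "\<bar>of_int (sign p) * (\<Prod>i\<in>UNIV. A $ i $ p i)\<bar> \<le> B ^ CARD('n)" by simp
  qed
  also have "\<dots> = fact CARD('n) * B ^ CARD('n)"
    by (simp add: card_permutations[OF refl])
  finally show ?thesis .
qed

lemma norm_matrix_le:
  fixes A :: "real^'n^'m" and B :: real
  assumes "\<And>i j. \<bar>A $ i $ j\<bar> \<le> B"
  shows "norm A \<le> CARD('m) * (CARD('n) * B)"
proof -
  have "norm (A $ i) \<le> CARD('n) * B" for i
  proof -
    have "norm (A $ i) \<le> (\<Sum>j\<in>UNIV. \<bar>A $ i $ j\<bar>)" by (rule norm_le_l1_cart)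
    also have "\<dots> \<le> (\<Sum>j\<in>(UNIV::'n set). B)" using assms by (intro sum_mono) auto
    finally show ?thesis by simp
  qed
  then have "(\<Sum>i\<in>UNIV. norm (A $ i)) \<le> (\<Sum>i\<in>(UNIV::'m set). CARD('n) * B)" by (intro sum_mono)
  then show ?thesis
    using L2_set_le_sum[of UNIV "\<lambda>i. norm (A $ i)"] by (simp add: norm_vec_def[of A])
qed

lemma norm_matrix_vector_le:
  fixes A :: "real^'n^'m"
  shows "norm (A *v x) \<le> CARD('m) * norm A * norm x"
proof -
  have "norm (A *v x) \<le> (\<Sum>i\<in>UNIV. \<bar>(A *v x) $ i\<bar>)" by (rule norm_le_l1_cart)
  also have "\<dots> \<le> (\<Sum>i\<in>(UNIV::'m set). norm A * norm x)"
  proof (rule sum_mono)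
    fix i
    have "\<bar>(A *v x) $ i\<bar> \<le> norm (A $ i) * norm x"
      by (simp add: matrix_vector_mul_component Cauchy_Schwarz_ineq2)
    also have "\<dots> \<le> norm A * norm x"
      by (intro mult_right_mono Finite_Cartesian_Product.norm_nth_le) auto
    finally show "\<bar>(A *v x) $ i\<bar> \<le> norm A * norm x" .
  qed
  also have "\<dots> = CARD('m) * norm A * norm x" by simp
  finally show ?thesis .
qed

text \<open>To be used with L = ln (\<alpha> / \<rho>): the amplitude is exponential in L, while the
  bound on the determinant is only polynomial in L, so L is bounded.\<close>

lemma power_less_exp_eventually:
  fixes K c :: real
  assumes "c > 0"
  shows "\<exists>L0. \<forall>L\<ge>L0. K * (1 + L / c) ^ n < exp L"
proof -
  have "((\<lambda>L. (1 + L / c) ^ n / exp L) \<longlongrightarrow> 0) at_top"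
  proof -
    have "((\<lambda>L. ((c + L) ^ n / exp (c + L)) * (exp c / c ^ n)) \<longlongrightarrow> 0 * (exp c / c ^ n)) at_top"
      by (intro tendsto_mult tendsto_const filterlim_compose[OF tendsto_power_div_exp_0]
          filterlim_tendsto_add_at_top[OF tendsto_const] filterlim_ident)
    moreover have "((c + L) ^ n / exp (c + L)) * (exp c / c ^ n) = (1 + L / c) ^ n / exp L" for L
    proof -
      have "(1 + L / c) ^ n = (c + L) ^ n / c ^ n"
        using assms by (simp add: power_divide[symmetric] add_divide_distrib)
      then show ?thesis by (simp add: exp_add)
    qed
    ultimately show ?thesis by simp
  qed
  then have "((\<lambda>L. K * ((1 + L / c) ^ n / exp L)) \<longlongrightarrow> K * 0) at_top"
    by (intro tendsto_mult tendsto_const)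
  then have "eventually (\<lambda>L. K * ((1 + L / c) ^ n / exp L) < 1) at_top"
    by (auto dest!: order_tendstoD(2)[of _ _ _ 1])
  then show ?thesis
    by (simp add: eventually_at_top_linorder field_simps)
qed

text \<open>On the ball \<open>A x + b\<close> is at most logarithmic in \<open>\<alpha>\<close>, hence so is \<open>A\<close>, while the bound on
  \<open>\<alpha> / \<bar>det A\<bar>\<close> makes \<open>\<alpha>\<close> polynomial in \<open>A\<close>.\<close>

lemma parameters_bounded:
  fixes x0 :: "real^'n" and M \<kappa> \<rho> r :: real
  assumes \<kappa>: "\<kappa> > 0" and \<rho>: "\<rho> > 0" and r: "r > 0"
  shows "\<exists>C. \<forall>\<psi> \<alpha> (A :: real^'n^'n) b.
    \<alpha> > 0 \<and> invertible A \<and> \<alpha> / \<bar>det A\<bar> \<le> M \<and> (\<forall>t\<ge>0. 0 \<le> \<psi> t \<and> \<kappa> * (t - 1) \<le> \<psi> t) \<and>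
      (\<forall>x\<in>cball x0 r. \<rho> \<le> ell \<psi> \<alpha> A b x) \<longrightarrow> \<rho> \<le> \<alpha> \<and> norm (\<alpha>, A, b) \<le> C"
proof -
  define n where "n = CARD('n)"
  \<comment> \<open>Read off from \<open>exp L \<le> K * T ^ n\<close> below, which combines the
    bound on the ratio, entries of size at most T / r and the Leibniz bound n! (T / r)^n on the
    determinant.\<close>
  define K where "K = \<bar>M\<bar> * fact n / (\<rho> * r ^ n)"
  obtain L0 where L0: "\<And>L. L \<ge> L0 \<Longrightarrow> K * (1 + L / \<kappa>) ^ n < exp L"
    using power_less_exp_eventually[OF \<kappa>] by blast
  define T0 where "T0 = 1 + L0 / \<kappa>"
  define C where "C = \<rho> * exp L0 + (real n * (real n * (T0 / r)) + (T0 + real n * (real n * (T0 / r)) * norm x0 * real n))"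
  show ?thesis
  proof (rule exI[of _ C], intro allI impI)
    fix \<psi> :: "real \<Rightarrow> real" and \<alpha> and A :: "real^'n^'n" and b
    assume "\<alpha> > 0 \<and> invertible A \<and> \<alpha> / \<bar>det A\<bar> \<le> M \<and> (\<forall>t\<ge>0. 0 \<le> \<psi> t \<and> \<kappa> * (t - 1) \<le> \<psi> t) \<and>
      (\<forall>x\<in>cball x0 r. \<rho> \<le> ell \<psi> \<alpha> A b x)"
    then have \<alpha>: "\<alpha> > 0" and A: "invertible A" and ratio: "\<alpha> / \<bar>det A\<bar> \<le> M"
      and nn: "\<And>t. t \<ge> 0 \<Longrightarrow> \<psi> t \<ge> 0" and lin: "\<And>t. t \<ge> 0 \<Longrightarrow> \<kappa> * (t - 1) \<le> \<psi> t"
      and ball: "\<And>x. x \<in> cball x0 r \<Longrightarrow> \<rho> \<le> ell \<psi> \<alpha> A b x"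
      by blast+
    define L where "L = ln (\<alpha> / \<rho>)"
    have \<alpha>L: "\<alpha> = \<rho> * exp L" using \<alpha> \<rho> by (simp add: L_def)
    define T where "T = 1 + L / \<kappa>"
    have psiL: "\<psi> (norm (A *v x + b)) \<le> L" if "x \<in> cball x0 r" for x
    proof -
      have "\<rho> \<le> \<rho> * exp L * exp (- \<psi> (norm (A *v x + b)))"
        using ball[OF that] by (simp add: ell_def \<alpha>L)
      then have "1 \<le> exp (L - \<psi> (norm (A *v x + b)))" using \<rho> by (simp add: exp_diff exp_minus field_simps)
      then show ?thesis by simp
    qed
    have x0: "x0 \<in> cball x0 r" using r by simp
    have L: "L \<ge> 0" using psiL[OF x0] nn[of "norm (A *v x0 + b)"] by simp
    have T: "norm (A *v x + b) \<le> T" if "x \<in> cball x0 r" for x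
      using psiL[OF that] lin[of "norm (A *v x + b)"] \<kappa> by (simp add: T_def field_simps)
    \<comment> \<open>The difference of the values at x0 + r e_j and x0 - r e_j isolates column j of
      \<open>A\<close> and eliminates \<open>b\<close>.\<close>
    have entry: "\<bar>A $ i $ j\<bar> \<le> T / r" for i j
    proof -
      let ?e = "axis j 1 :: real^'n"
      have "A *v (x0 + r *\<^sub>R ?e) + b - (A *v (x0 - r *\<^sub>R ?e) + b) = (2 * r) *\<^sub>R (A *v ?e)"
        by (simp add: matrix_vector_right_distrib matrix_vector_mult_diff_distrib matrix_vector_mult_scaleR flip: scaleR_add_left)
      moreover have "norm (A *v (x0 + r *\<^sub>R ?e) + b - (A *v (x0 - r *\<^sub>R ?e) + b)) \<le> T + T"
        using r by (intro order_trans[OF norm_triangle_ineq4] add_mono T) (auto simp: dist_norm)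
      ultimately have "2 * r * norm (A *v ?e) \<le> T + T" using r by simp
      then have "norm (A *v ?e) \<le> T / r" using r by (simp add: field_simps)
      with abs_matrix_entry_le_norm[of A i j] show ?thesis by linarith
    qed
    have T0': "T \<ge> 0" using norm_ge_zero T[OF x0] by (rule order_trans)
    have dA: "\<bar>det A\<bar> > 0" using A by (simp add: invertible_det_nz)
    have "\<rho> * exp L \<le> M * \<bar>det A\<bar>" using ratio dA by (simp add: \<alpha>L field_simps)
    also have "\<dots> \<le> \<bar>M\<bar> * (fact n * (T / r) ^ n)"
      unfolding n_def by (intro mult_mono abs_det_le entry) auto
    finally have "exp L \<le> K * T ^ n" using \<rho> r by (simp add: K_def field_simps power_divide)
    then have "L < L0" using L0[of L] by (force simp: T_def)
    then have TT: "T \<le> T0" using \<kappa> by (simp add: T_def T0_def divide_right_mono)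
    have "norm A \<le> real n * (real n * (T / r))" unfolding n_def by (intro norm_matrix_le entry)
    also have "\<dots> \<le> real n * (real n * (T0 / r))" using TT r by (intro mult_left_mono divide_right_mono) auto
    finally have nA: "norm A \<le> real n * (real n * (T0 / r))" .
    have "norm b \<le> norm (A *v x0 + b) + norm (A *v x0)"
      by (metis add.commute add_diff_cancel_left' norm_triangle_ineq4)
    also have "norm (A *v x0) \<le> real n * (real n * (T0 / r)) * norm x0 * real n"
      using mult_left_mono[OF nA, of "real n * norm x0"] norm_matrix_vector_le[of A x0]
      by (simp add: n_def mult_ac)
    finally have nb: "norm b \<le> T0 + real n * (real n * (T0 / r)) * norm x0 * real n"
      using T[OF x0] TT by linarith
    have "norm \<alpha> \<le> \<rho> * exp L0" using \<open>L < L0\<close> \<rho> by (simp add: \<alpha>L)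
    then have "norm (\<alpha>, A, b) \<le> C"
      unfolding C_def
      using norm_Pair_le[of \<alpha> "(A, b)"] norm_Pair_le[of A b] nA nb by linarith
    moreover have "\<rho> \<le> \<alpha>" using L \<rho> by (simp add: \<alpha>L)
    ultimately show "\<rho> \<le> \<alpha> \<and> norm (\<alpha>, A, b) \<le> C" by simp
  qed
qed

lemma tendsto_matrix_vector_mult [tendsto_intros]:
  fixes A :: "'a \<Rightarrow> real^'n^'m"
  assumes "(A \<longlongrightarrow> A0) F" "(x \<longlongrightarrow> x0) F"
  shows "((\<lambda>k. A k *v x k) \<longlongrightarrow> A0 *v x0) F"
  unfolding matrix_vector_mult_def
  by (intro vec_tendstoI) (auto intro!: tendsto_intros assms)

lemma tendsto_det [tendsto_intros]:
  fixes A :: "'a \<Rightarrow> real^'n^'n"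
  assumes "(A \<longlongrightarrow> A0) F"
  shows "((\<lambda>k. det (A k)) \<longlongrightarrow> det A0) F"
  unfolding det_def by (intro tendsto_intros assms)

text \<open>Used with a constant profile for existence and with growing s for the Gaussian limit.
  The limit stays non-degenerate because \<rho> \<le> \<alpha> k and the bounded ratio give \<rho>
  \<le> M |det (A k)|. Hypothesis \<open>conv\<close> allows moving arguments, as A k x + b k moves
  with k, and subsequences, as only along these the parameters converge.\<close>

lemma feasible_subsequence:
  fixes A :: "nat \<Rightarrow> real^'n^'n" and f :: "real^'n \<Rightarrow> real"
  assumes \<kappa>: "\<kappa> > 0" and \<rho>: "\<rho> > 0" and r: "r > 0"
    and f_ball: "\<forall>x\<in>cball x0 r. \<rho> \<le> f x"
    and \<alpha>: "\<And>k. \<alpha> k > 0" and A: "\<And>k. invertible (A k)" and ratio: "\<And>k. \<alpha> k / \<bar>det (A k)\<bar> \<le> M"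
    and le: "\<And>k. f \<le> ell (\<psi> k) (\<alpha> k) (A k) (b k)"
    and nn: "\<And>k t. t \<ge> 0 \<Longrightarrow> \<psi> k t \<ge> 0" and lin: "\<And>k t. t \<ge> 0 \<Longrightarrow> \<kappa> * (t - 1) \<le> \<psi> k t"
    and conv: "\<And>t t0 (\<sigma> :: nat \<Rightarrow> nat). strict_mono \<sigma> \<Longrightarrow> t \<longlonglongrightarrow> t0 \<Longrightarrow> (\<lambda>k. \<psi> (\<sigma> k) (t k)) \<longlonglongrightarrow> \<psi>' t0"
  obtains \<sigma> \<alpha>' A' b' where "strict_mono (\<sigma> :: nat \<Rightarrow> nat)"
    "(\<lambda>k. \<alpha> (\<sigma> k)) \<longlonglongrightarrow> \<alpha>'" "(\<lambda>k. A (\<sigma> k)) \<longlonglongrightarrow> A'" "(\<lambda>k. b (\<sigma> k)) \<longlonglongrightarrow> b'"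
    "\<alpha>' > 0" "invertible A'" "f \<le> ell \<psi>' \<alpha>' A' b'"
proof -
  have "\<forall>x\<in>cball x0 r. \<rho> \<le> ell (\<psi> k) (\<alpha> k) (A k) (b k) x" for k
    using f_ball le[of k] by (meson le_funD order_trans)
  then obtain C where C: "\<And>k. \<rho> \<le> \<alpha> k \<and> norm (\<alpha> k, A k, b k) \<le> C"
    using parameters_bounded[OF \<kappa> \<rho> r, of M x0] \<alpha> A ratio nn lin by metis
  have "bounded (range (\<lambda>k. (\<alpha> k, A k, b k)))" using C by (auto simp: bounded_iff)
  then obtain l \<sigma> where \<sigma>: "strict_mono (\<sigma> :: nat \<Rightarrow> nat)" and lim: "((\<lambda>k. (\<alpha> k, A k, b k)) \<circ> \<sigma>) \<longlonglongrightarrow> l"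
    using bounded_imp_convergent_subsequence by blast
  obtain \<alpha>' A' b' where l: "l = (\<alpha>', A', b')" by (cases l)
  have l1: "(\<lambda>k. \<alpha> (\<sigma> k)) \<longlonglongrightarrow> \<alpha>'" using tendsto_fst[OF lim] by (simp add: o_def l)
  have l2: "(\<lambda>k. A (\<sigma> k)) \<longlonglongrightarrow> A'" using tendsto_fst[OF tendsto_snd[OF lim]] by (simp add: o_def l)
  have l3: "(\<lambda>k. b (\<sigma> k)) \<longlonglongrightarrow> b'" using tendsto_snd[OF tendsto_snd[OF lim]] by (simp add: o_def l)
  have "\<rho> \<le> \<alpha>'" using C by (intro tendsto_lowerbound[OF l1]) auto
  with \<rho> have \<alpha>': "\<alpha>' > 0" by simp
  have dA: "\<rho> \<le> M * \<bar>det (A k)\<bar>" for k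
  proof -
    have "\<bar>det (A k)\<bar> > 0" using A[of k] by (simp add: invertible_det_nz)
    then have "\<alpha> k \<le> M * \<bar>det (A k)\<bar>" using ratio[of k] by (simp add: field_simps)
    with C[of k] show ?thesis by linarith
  qed
  have "(\<lambda>k. M * \<bar>det (A (\<sigma> k))\<bar>) \<longlonglongrightarrow> M * \<bar>det A'\<bar>"
    by (intro tendsto_intros l2)
  then have "\<rho> \<le> M * \<bar>det A'\<bar>" using dA by (intro tendsto_lowerbound) auto
  then have A': "invertible A'" using \<rho> by (auto simp: invertible_det_nz)
  have "f x \<le> ell \<psi>' \<alpha>' A' b' x" for x
  proof (rule tendsto_lowerbound)
    show "(\<lambda>k. ell (\<psi> (\<sigma> k)) (\<alpha> (\<sigma> k)) (A (\<sigma> k)) (b (\<sigma> k)) x) \<longlonglongrightarrow> ell \<psi>' \<alpha>' A' b' x"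
      unfolding ell_def by (intro tendsto_intros conv \<sigma> l1 l2 l3)
    show "\<forall>\<^sub>F k in sequentially. f x \<le> ell (\<psi> (\<sigma> k)) (\<alpha> (\<sigma> k)) (A (\<sigma> k)) (b (\<sigma> k)) x"
      using le by (simp add: le_fun_def)
  qed auto
  then have "f \<le> ell \<psi>' \<alpha>' A' b'" by (simp add: le_fun_def)
  with that[OF \<sigma> l1 l2 l3 \<alpha>' A'] show thesis .
qed

lemma (in profile) optimal_exists:
  fixes f :: "real^'n \<Rightarrow> real"
  assumes \<rho>: "\<rho> > 0" and r: "r > 0" and f_ball: "\<forall>x\<in>cball x0 r. \<rho> \<le> f x"
    and feas: "\<alpha>0 > 0" "invertible A0" "f \<le> ell \<psi> \<alpha>0 A0 b0"
  shows "\<exists>\<alpha> A b. optimal \<psi> f \<alpha> A b"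
proof -
  define V where "V = {\<alpha> / \<bar>det A\<bar> | \<alpha> (A :: real^'n^'n) b. \<alpha> > 0 \<and> invertible A \<and> f \<le> ell \<psi> \<alpha> A b}"
  have Vne: "V \<noteq> {}" using feas unfolding V_def by blast
  have Vb: "bdd_below V" unfolding V_def by (rule bdd_belowI[of _ 0]) auto
  have "\<exists>\<alpha> (A :: real^'n^'n) b. \<alpha> > 0 \<and> invertible A \<and> f \<le> ell \<psi> \<alpha> A b \<and> \<alpha> / \<bar>det A\<bar> < Inf V + 1 / Suc k" for k
  proof -
    have "Inf V < Inf V + 1 / Suc k" by simp
    then obtain v where "v \<in> V" "v < Inf V + 1 / Suc k" using cInf_less_iff[OF Vne Vb] by blast
    then show ?thesis unfolding V_def by blast
  qed
  then obtain \<alpha> b and A :: "nat \<Rightarrow> real^'n^'n" where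
    \<alpha>: "\<And>k. \<alpha> k > 0" and A: "\<And>k. invertible (A k)" and le: "\<And>k. f \<le> ell \<psi> (\<alpha> k) (A k) (b k)"
    and lt: "\<And>k. \<alpha> k / \<bar>det (A k)\<bar> < Inf V + 1 / Suc k" by metis
  have ratio: "\<alpha> k / \<bar>det (A k)\<bar> \<le> Inf V + 1" for k
  proof -
    have "1 / real (Suc k) \<le> 1" by simp
    with lt[of k] show ?thesis by linarith
  qed
  obtain \<sigma> \<alpha>' A' b' where \<sigma>: "strict_mono (\<sigma> :: nat \<Rightarrow> nat)"
    and l: "(\<lambda>k. \<alpha> (\<sigma> k)) \<longlonglongrightarrow> \<alpha>'" "(\<lambda>k. A (\<sigma> k)) \<longlonglongrightarrow> A'" "(\<lambda>k. b (\<sigma> k)) \<longlonglongrightarrow> b'"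
    and feas': "\<alpha>' > 0" "invertible A'" "f \<le> ell \<psi> \<alpha>' A' b'"
  proof (rule feasible_subsequence[OF one_pos \<rho> r f_ball \<alpha> A ratio le])
    show "(\<lambda>k. \<psi> (t k)) \<longlonglongrightarrow> \<psi> t0" if "t \<longlonglongrightarrow> t0" for t t0
      using isCont_tendsto_compose[OF isCont_profile that] .
  qed (auto intro: nonneg linear_lower_bound)
  have d0: "det A' \<noteq> 0" using feas' by (simp add: invertible_det_nz)
  have "\<alpha>' / \<bar>det A'\<bar> \<le> Inf V"
  proof (rule tendsto_le[OF sequentially_bot])
    show "(\<lambda>k. \<alpha> (\<sigma> k) / \<bar>det (A (\<sigma> k))\<bar>) \<longlonglongrightarrow> \<alpha>' / \<bar>det A'\<bar>"
      using d0 by (intro tendsto_intros l) auto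
    have "(\<lambda>k. Inf V + 1 / Suc k) \<longlonglongrightarrow> Inf V + 0"
      by (intro tendsto_intros LIMSEQ_Suc[OF lim_1_over_n])
    from LIMSEQ_subseq_LIMSEQ[OF this \<sigma>]
    show "(\<lambda>k. Inf V + 1 / Suc (\<sigma> k)) \<longlonglongrightarrow> Inf V" by (simp add: o_def)
    show "\<forall>\<^sub>F k in sequentially. \<alpha> (\<sigma> k) / \<bar>det (A (\<sigma> k))\<bar> \<le> Inf V + 1 / Suc (\<sigma> k)"
      using lt by (intro always_eventually allI less_imp_le)
  qed
  then have "optimal \<psi> f \<alpha>' A' b'"
    unfolding optimal_def using feas' cInf_lower[OF _ Vb] by (fastforce simp: V_def)
  then show ?thesis by blast
qed

section \<open>Log-concave functions\<close>

lemma log_concave_powr: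
  assumes lc: "log_concave f" and uv: "u > 0" "v > 0" "u + v = 1"
  shows "f x powr u * f y powr v \<le> f (u *\<^sub>R x + v *\<^sub>R y)"
proof -
  obtain \<phi> where \<phi>: "convex_extended \<phi>" and f: "f = (\<lambda>x. exp_neg (\<phi> x))"
    using lc by (auto simp: log_concave_def)
  show ?thesis
  proof (cases "\<phi> x = \<infinity> \<or> \<phi> y = \<infinity>")
    case True
    \<comment> \<open>At an infinite value \<open>f\<close> is 0, and \<open>0 powr u = 0\<close>
      makes the left side vanish.\<close>
    then show ?thesis by (auto simp: f exp_neg_def)
  next
    case False
    have "\<phi> z \<noteq> -\<infinity>" for z using \<phi> by (auto simp: convex_extended_def)
    with False obtain a b where a: "\<phi> x = ereal a" and b: "\<phi> y = ereal b" by (metis ereal_cases)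
    have le: "\<phi> (u *\<^sub>R x + v *\<^sub>R y) \<le> ereal (u * a + v * b)"
      using \<phi> uv a b unfolding convex_extended_def by (metis plus_ereal.simps(1) times_ereal.simps(1))
    then obtain c where c: "\<phi> (u *\<^sub>R x + v *\<^sub>R y) = ereal c"
      using \<open>\<And>z. \<phi> z \<noteq> -\<infinity>\<close> by (cases "\<phi> (u *\<^sub>R x + v *\<^sub>R y)") auto
    have "c \<le> u * a + v * b" using le c by simp
    then show ?thesis by (simp add: f exp_neg_def a b c powr_def exp_add[symmetric])
  qed
qed

lemma convex_superlevel_log_concave:
  assumes lc: "log_concave f" and c: "c > 0"
  shows "convex {x. c \<le> f x}"
proof (rule convexI)
  fix x y and u v :: real
  assume x: "x \<in> {x. c \<le> f x}" and y: "y \<in> {x. c \<le> f x}" and uv: "0 \<le> u" "0 \<le> v" "u + v = 1"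
  show "u *\<^sub>R x + v *\<^sub>R y \<in> {x. c \<le> f x}"
  proof (cases "u = 0 \<or> v = 0")
    case True
    then show ?thesis using x y uv by auto
  next
    case False
    have "c = c powr u * c powr v" using c uv by (simp flip: powr_add)
    also have "\<dots> \<le> f x powr u * f y powr v"
      using x y c uv by (intro mult_mono powr_mono2) auto
    also have "\<dots> \<le> f (u *\<^sub>R x + v *\<^sub>R y)"
      using False uv by (intro log_concave_powr[OF lc]) auto
    finally show ?thesis by simp
  qed
qed

lemma open_sublevel_upper_semicontinuous:
  assumes "upper_semicontinuous f"
  shows "open {x. f x < c}"
proof (subst open_subopen, intro ballI)
  fix x assume "x \<in> {x. f x < c}"
  then have "eventually (\<lambda>y. f y < c) (nhds x)" using assms by (auto simp: upper_semicontinuous_def)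
  then show "\<exists>T. open T \<and> x \<in> T \<and> T \<subseteq> {x. f x < c}" by (auto simp: eventually_nhds)
qed

lemma borel_measurable_upper_semicontinuous:
  "upper_semicontinuous f \<Longrightarrow> f \<in> borel_measurable borel"
  by (subst borel_measurable_iff_less) (auto intro: borel_open open_sublevel_upper_semicontinuous)

lemma bounded_above_upper_semicontinuous:
  assumes "upper_semicontinuous f" "compact K"
  obtains B where "B \<ge> 0" "\<And>x. x \<in> K \<Longrightarrow> f x \<le> B"
proof -
  have "K \<subseteq> (\<Union>n\<in>UNIV. {x. f x < real n})" by (auto simp: reals_Archimedean2)
  then obtain N where N: "finite N" "K \<subseteq> (\<Union>n\<in>N. {x. f x < real n})"
    using compactE_image[OF assms(2), of UNIV "\<lambda>n. {x. f x < real n}"]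
      open_sublevel_upper_semicontinuous[OF assms(1)] by metis
  have "f x \<le> real (\<Sum>N)" if x: "x \<in> K" for x
  proof -
    obtain n where "n \<in> N" "f x < real n" using subsetD[OF N(2) x] by blast
    moreover from this N(1) have "n \<le> \<Sum>N" by (intro member_le_sum) auto
    ultimately show ?thesis by linarith
  qed
  then show thesis using that[OF of_nat_0_le_iff] by blast
qed

text \<open>The superlevel sets are convex, and a convex set with empty interior is negligible. If
  all levels 1 / (n + 1) had empty interior, \<open>f\<close> would vanish almost everywhere,
  against the positive integral.\<close>

lemma log_concave_ge_on_ball:
  fixes f :: "'a::euclidean_space \<Rightarrow> real"
  assumes usc: "upper_semicontinuous f" and lc: "log_concave f"
    and pos: "0 < (\<integral>\<^sup>+x. ennreal (f x) \<partial>lborel)"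
  obtains \<rho> x0 r where "\<rho> > 0" "r > 0" "\<forall>x\<in>cball x0 r. \<rho> \<le> f x"
proof -
  have [measurable]: "f \<in> borel_measurable borel" by (rule borel_measurable_upper_semicontinuous[OF usc])
  have "\<exists>n. interior {x. 1 / Suc n \<le> f x} \<noteq> {}"
  proof (rule ccontr)
    assume "\<not> ?thesis"
    then have "negligible {x. 1 / Suc n \<le> f x}" for n
      by (subst negligible_convex_interior) (auto intro!: convex_superlevel_log_concave lc)
    then have "{x. 1 / Suc n \<le> f x} \<in> null_sets lborel" for n
      by (simp add: negligible_iff_null_sets null_sets_completion_iff)
    then have "AE x in lborel. \<not> 1 / Suc n \<le> f x" for n
      using AE_not_in[of "{x. 1 / Suc n \<le> f x}" lborel] by simp
    then have "AE x in lborel. \<forall>n. \<not> 1 / Suc n \<le> f x"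
      by (subst AE_all_countable) blast
    then have "AE x in lborel. ennreal (f x) = 0"
    proof (rule AE_mp, intro AE_I2 impI)
      fix x assume *: "\<forall>n. \<not> 1 / Suc n \<le> f x"
      have "f x \<le> 0"
      proof (rule ccontr)
        assume "\<not> f x \<le> 0"
        then obtain n where "1 / Suc n < f x" using reals_Archimedean[of "f x"] by (auto simp: inverse_eq_divide)
        with * show False by (meson less_imp_le)
      qed
      then show "ennreal (f x) = 0" by (simp add: ennreal_neg)
    qed
    then have "(\<integral>\<^sup>+x. ennreal (f x) \<partial>lborel) = 0"
      by (subst nn_integral_0_iff_AE) auto
    with pos show False by simp
  qed
  then obtain n x0 where "x0 \<in> interior {x. 1 / Suc n \<le> f x}" by blast
  then obtain r where "r > 0" "cball x0 r \<subseteq> {x. 1 / Suc n \<le> f x}" by (auto simp: mem_interior_cball)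
  then show thesis by (intro that[of "1 / Suc n" r x0]) auto
qed

text \<open>Along the segment from the ball to a far point of the set, many disjoint balls of half the
  radius fit into the first half.\<close>

lemma convex_finite_measure_bounded:
  fixes K :: "'a::euclidean_space set"
  assumes K: "convex K" and ball: "cball x0 r \<subseteq> K" and r: "r > 0"
    and fin: "emeasure lborel K < \<infinity>" and [measurable]: "K \<in> sets borel"
  obtains R where "R > 0" "\<And>x. x \<in> K \<Longrightarrow> norm (x - x0) < R"
proof -
  define v where "v = unit_ball_vol DIM('a) * (r / 2) ^ DIM('a)"
  have v: "v > 0" using r unfolding v_def by (intro mult_pos_pos unit_ball_vol_pos) auto
  have vol: "emeasure lborel (ball z (r / 2) :: 'a set) = ennreal v" for z
    using r by (simp add: emeasure_ball v_def)
  obtain m where m: "m \<ge> 0" "emeasure lborel K = ennreal m"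
    using fin by (cases "emeasure lborel K") auto
  \<comment> \<open>The indices j \<le> N give N + 1 balls of volume \<open>v\<close>, whose total
    volume exceeds the measure of \<open>K\<close>.\<close>
  obtain N :: nat where "m / v < real N" using reals_Archimedean2 by blast
  then have "m < real N * v" using v by (simp add: pos_divide_less_eq)
  then have Nv: "m < real (Suc N) * v" using v by (simp add: distrib_right)
  have "0 < real N" using \<open>m < real N * v\<close> m v by (metis le_less_trans zero_less_mult_pos2)
  then have N0: "N > 0" by simp
  have "norm (x - x0) < 2 * r * N" if x: "x \<in> K" for x
  proof (rule ccontr)
    assume "\<not> ?thesis"
    then have far: "2 * r * N \<le> norm (x - x0)" by simp
    \<comment> \<open>The parameters j / (2 N) run through [0, 1/2]. Neighbouring centres are at
      distance |x - x0| / (2 N) \<ge> r, so balls of radius r / 2 around them are disjoint.\<close>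
    define c where "c j = x0 + (real j / (2 * N)) *\<^sub>R (x - x0)" for j
    define B where "B j = ball (c j) (r / 2)" for j
    have sub: "B j \<subseteq> K" if j: "j \<le> N" for j
    proof
      fix z assume z: "z \<in> B j"
      \<comment> \<open>\<open>z\<close> is a convex combination of \<open>x\<close>, with weight t,
        and a point near x0. The deviation of \<open>z\<close> from the centre is divided by 1 - t
        \<ge> 1/2, so that this point still lies within distance r of x0.\<close>
      define t where "t = real j / (2 * N)"
      have t: "0 \<le> t" "t \<le> 1/2" using j N0 by (auto simp: t_def field_simps)
      define w where "w = z - c j"
      have w: "norm w < r / 2" using z by (simp add: B_def w_def dist_norm norm_minus_commute)
      have "norm ((1 / (1 - t)) *\<^sub>R w) \<le> r"
      proof -
        have "norm w \<le> r * (1/2)" using w by simp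
        also have "\<dots> \<le> r * (1 - t)" using t r by (intro mult_left_mono) auto
        finally show ?thesis using t by (simp add: field_simps)
      qed
      then have "x0 + (1 / (1 - t)) *\<^sub>R w \<in> K" using ball by (auto simp: dist_norm)
      then have "t *\<^sub>R x + (1 - t) *\<^sub>R (x0 + (1 / (1 - t)) *\<^sub>R w) \<in> K"
        using K x t by (intro convexD) auto
      moreover have "t *\<^sub>R x + (1 - t) *\<^sub>R (x0 + (1 / (1 - t)) *\<^sub>R w) = z"
      proof -
        have "(1 - t) *\<^sub>R (x0 + (1 / (1 - t)) *\<^sub>R w) = (1 - t) *\<^sub>R x0 + w"
          using t by (simp add: scaleR_add_right)
        moreover have "c j = x0 + t *\<^sub>R (x - x0)" by (simp add: c_def t_def)
        then have "t *\<^sub>R x + ((1 - t) *\<^sub>R x0 + w) = z"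
          by (simp add: w_def algebra_simps)
        ultimately show ?thesis by (simp only:)
      qed
      ultimately show "z \<in> K" by simp
    qed
    have "disjoint_family_on B {..N}"
    proof (unfold disjoint_family_on_def, intro ballI impI)
      fix i j :: nat assume "i \<noteq> j"
      show "B i \<inter> B j = {}"
      proof (rule ccontr)
        assume "B i \<inter> B j \<noteq> {}"
        then obtain z where "dist (c i) z < r / 2" "dist (c j) z < r / 2" by (auto simp: B_def)
        then have "dist (c i) (c j) < r" using dist_triangle2[of "c i" "c j" z] by linarith
        moreover have "dist (c i) (c j) = \<bar>real i - real j\<bar> * (norm (x - x0) / (2 * N))"
        proof -
          have "c i - c j = ((real i - real j) / (2 * N)) *\<^sub>R (x - x0)"
            by (simp add: c_def diff_divide_distrib scaleR_left_diff_distrib)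
          then show ?thesis by (simp add: dist_norm abs_divide)
        qed
        moreover have "1 * r \<le> \<bar>real i - real j\<bar> * (norm (x - x0) / (2 * N))"
        proof (rule mult_mono)
          show "r \<le> norm (x - x0) / (2 * N)" using far N0 by (simp add: field_simps)
          show "1 \<le> \<bar>real i - real j\<bar>" using \<open>i \<noteq> j\<close> by linarith
        qed (use r in auto)
        ultimately show False by simp
      qed
    qed
    moreover have "B ` {..N} \<subseteq> sets lborel" by (auto simp: B_def)
    ultimately have "(\<Sum>j\<in>{..N}. emeasure lborel (B j)) = emeasure lborel (\<Union>j\<in>{..N}. B j)"
      by (intro sum_emeasure) auto
    also have "\<dots> \<le> emeasure lborel K" using sub by (intro emeasure_mono) auto
    finally have "ennreal (real (Suc N) * v) \<le> ennreal m"
      using m v by (simp add: B_def vol ennreal_mult' flip: ennreal_of_nat_eq_real_of_nat)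
    then show False using Nv m by (simp add: ennreal_le_iff)
  qed
  moreover have "2 * r * N > 0" using r N0 by simp
  ultimately show thesis using that by blast
qed

text \<open>The superlevel set at \<rho> / e has finite measure and is therefore bounded, of radius
  R around x0. On a ray from x0 the logarithm has dropped by at least 1 at distance R; by concavity
  the drop continues at least linearly, with rate 1 / R.\<close>

lemma log_concave_exponential_decay:
  fixes f :: "'a::euclidean_space \<Rightarrow> real"
  assumes usc: "upper_semicontinuous f" and lc: "log_concave f"
    and fin: "(\<integral>\<^sup>+x. ennreal (f x) \<partial>lborel) < \<infinity>"
    and \<rho>: "\<rho> > 0" and r: "r > 0" and ball: "\<forall>x\<in>cball x0 r. \<rho> \<le> f x"
  obtains C c where "C > 0" "c > 0" "\<And>x. f x \<le> C * exp (- c * norm (x - x0))"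
proof -
  have [measurable]: "f \<in> borel_measurable borel" by (rule borel_measurable_upper_semicontinuous[OF usc])
  define h where "h = \<rho> * exp (-1)"
  have h: "h > 0" "h \<le> \<rho>" using \<rho> by (simp_all add: h_def)
  define K where "K = {x. h \<le> f x}"
  have [measurable]: "K \<in> sets borel" unfolding K_def by measurable
  have "ennreal h * emeasure lborel K = (\<integral>\<^sup>+x. ennreal h * indicator K x \<partial>lborel)"
    by (subst nn_integral_cmult_indicator) auto
  also have "\<dots> \<le> (\<integral>\<^sup>+x. ennreal (f x) \<partial>lborel)"
    by (intro nn_integral_mono) (auto simp: K_def indicator_def ennreal_leI)
  finally have "ennreal h * emeasure lborel K < \<infinity>" using fin by simp
  then have finK: "emeasure lborel K < \<infinity>"
    using h by (auto simp: ennreal_mult_less_top less_top)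
  have "convex K" unfolding K_def by (rule convex_superlevel_log_concave[OF lc h(1)])
  moreover have "cball x0 r \<subseteq> K" using ball h by (fastforce simp: K_def)
  ultimately obtain R where R: "R > 0" "\<And>x. x \<in> K \<Longrightarrow> norm (x - x0) < R"
    using convex_finite_measure_bounded[OF _ _ r finK] by auto
  obtain B where B: "B \<ge> 0" "\<And>x. x \<in> cball x0 R \<Longrightarrow> f x \<le> B"
    using bounded_above_upper_semicontinuous[OF usc compact_cball] by blast
  \<comment> \<open>The summand \<open>B * exp 1\<close> serves inside radius R, where the
    exponential factor is at least 1 / e; the summand \<rho> serves outside.\<close>
  define C where "C = \<rho> + B * exp 1"
  have "f x \<le> C * exp (- (1 / R) * norm (x - x0))" for x
  proof (cases "norm (x - x0) \<le> R")
    case True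
    have "f x \<le> B" using B True by (simp add: dist_norm norm_minus_commute)
    also have "B * 1 \<le> B * (exp 1 * exp (- (1 / R) * norm (x - x0)))"
      using B(1) True R by (intro mult_left_mono) (simp_all add: exp_add[symmetric] field_simps)
    finally have "f x \<le> B * exp 1 * exp (- (1 / R) * norm (x - x0))" by (simp add: mult.assoc)
    moreover have "0 \<le> \<rho> * exp (- (1 / R) * norm (x - x0))" using \<rho> by simp
    ultimately show ?thesis unfolding C_def distrib_right by linarith
  next
    case False
    define D where "D = norm (x - x0)"
    have D: "D > R" using False by (simp add: D_def)
    define t where "t = R / D"
    have t: "0 < t" "t < 1" using D R by (auto simp: t_def)
    \<comment> \<open>The point of the segment from x0 to \<open>x\<close> at distance R from x0,
      where \<open>f\<close> is already below \<open>h\<close>.\<close>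
    define y where "y = t *\<^sub>R x + (1 - t) *\<^sub>R x0"
    have "y - x0 = t *\<^sub>R (x - x0)" by (simp add: y_def algebra_simps)
    then have "norm (y - x0) = R" using t D R by (simp add: t_def D_def[symmetric])
    then have "y \<notin> K" using R(2)[of y] by auto
    then have fy: "f y < h" by (simp add: K_def)
    have "f x \<le> \<rho> * exp (- (1 / R) * D)"
    proof (cases "f x \<le> 0")
      case True
      then show ?thesis using \<rho> by (meson exp_ge_zero less_imp_le mult_nonneg_nonneg order_trans)
    next
      case fx: False
      have "f x powr t * \<rho> powr (1 - t) \<le> f x powr t * f x0 powr (1 - t)"
        using bspec[OF ball, of x0] r \<rho> t by (intro mult_left_mono powr_mono2) auto
      also have "\<dots> \<le> f y" unfolding y_def using t by (intro log_concave_powr[OF lc]) auto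
      finally have "ln (f x powr t * \<rho> powr (1 - t)) < ln h"
        using fy fx \<rho> h by (intro ln_less_cancel_iff[THEN iffD2]) auto
      then have "t * ln (f x) + (1 - t) * ln \<rho> < ln \<rho> - 1"
        using fx \<rho> by (simp add: ln_mult ln_powr h_def)
      then have "t * (ln (f x) - ln \<rho>) < - 1" by (simp add: algebra_simps)
      then have "ln (f x) - ln \<rho> < - 1 / t"
        by (simp only: pos_less_divide_eq[OF t(1)] mult.commute)
      also have "- 1 / t = - (1 / R) * D" by (simp add: t_def)
      finally have "ln (f x) \<le> ln \<rho> + - (1 / R) * D" by simp
      then have "exp (ln (f x)) \<le> exp (ln \<rho> + - (1 / R) * D)" by (simp only: exp_le_cancel_iff)
      also have "\<dots> = \<rho> * exp (- (1 / R) * D)" unfolding exp_add using \<rho> by simp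
      finally show ?thesis using fx by simp
    qed
    also have "\<dots> \<le> C * exp (- (1 / R) * D)"
      using B by (intro mult_right_mono) (auto simp: C_def)
    finally show ?thesis by (simp add: D_def)
  qed
  moreover have "C > 0" using \<rho> B by (simp add: C_def add_pos_nonneg)
  ultimately show thesis using that[of C "1 / R"] R by simp
qed

section \<open>The rescaled profiles\<close>

text \<open>The square root in \<open>psi\<close> at the argument sqrt (2 s) t, since 4 (sqrt (2 s)
  t / s)^2 = 8 t^2 / s.\<close>

definition psi_root :: "real \<Rightarrow> real \<Rightarrow> real" where
  "psi_root s t = sqrt (1 + 8 * t\<^sup>2 / s)"

text \<open>\<open>\<psi>\<^sub>s\<close> with its argument rescaled by \<open>sqrt (2 s)\<close>, which makes it increase to \<open>t\<^sup>2\<close> as \<open>s\<close> tends to infinity.\<close>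

definition psi_scaled :: "real \<Rightarrow> real \<Rightarrow> real" where
  "psi_scaled s t = s / 2 * (psi_root s t - ln ((1 + psi_root s t) / 2) - 1)"

text \<open>The chain rule gives (4 t / w) (1 - 1 / (1 + w)) with w the root, and w cancels. This
  form makes the comparisons between different s, with t^2 and with linear functions visible: all
  concern the size of w.\<close>

definition psi_scaled_deriv :: "real \<Rightarrow> real \<Rightarrow> real" where
  "psi_scaled_deriv s t = 4 * t / (1 + psi_root s t)"

lemma psi_root_ge_1: "s > 0 \<Longrightarrow> 1 \<le> psi_root s t"
  by (simp add: psi_root_def)

lemma psi_root_square: "s > 0 \<Longrightarrow> (psi_root s t)\<^sup>2 = 1 + 8 * t\<^sup>2 / s"
  by (simp add: psi_root_def add_nonneg_nonneg)

lemma psi_scaled_has_deriv: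
  assumes s: "s > 0"
  shows "(psi_scaled s has_real_derivative psi_scaled_deriv s t) (at t)"
proof -
  define w where "w = psi_root s t"
  have w: "w \<ge> 1" using psi_root_ge_1[OF s] by (simp add: w_def)
  have pos: "1 + 8 * t\<^sup>2 / s > 0" using s by (intro add_pos_nonneg) auto
  have root: "(psi_root s has_real_derivative (8 * t / s) / w) (at t)"
    unfolding psi_root_def w_def using pos s
    by (auto intro!: derivative_eq_intros simp: field_simps)
  have "(psi_scaled s has_real_derivative s / 2 * ((8 * t / s) / w - ((8 * t / s) / w / 2) / ((1 + w) / 2) - 0)) (at t)"
    unfolding psi_scaled_def
    by (rule derivative_eq_intros root refl | use w in \<open>simp add: w_def\<close>)+
  moreover have "s / 2 * ((8 * t / s) / w - ((8 * t / s) / w / 2) / ((1 + w) / 2) - 0) = 4 * t / (1 + w)"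
    using s w by (simp add: divide_simps) (simp add: algebra_simps)
  ultimately show ?thesis by (simp only: psi_scaled_deriv_def w_def)
qed

lemma psi_scaled_deriv_strict_mono:
  assumes s: "s > 0" and ab: "0 \<le> a" "a < b"
  shows "psi_scaled_deriv s a < psi_scaled_deriv s b"
proof -
  let ?u = "psi_root s a" and ?v = "psi_root s b"
  \<comment> \<open>After clearing denominators a v \<le> b u suffices. In the squares the terms 8
    a^2 b^2 / s agree, so only a^2 \<le> b^2 is left.\<close>
  have "(a * ?v)\<^sup>2 \<le> (b * ?u)\<^sup>2"
  proof -
    have "a\<^sup>2 \<le> b\<^sup>2" using ab by (intro power_mono) auto
    then have "a\<^sup>2 * (1 + 8 * b\<^sup>2 / s) \<le> b\<^sup>2 * (1 + 8 * a\<^sup>2 / s)" by (simp add: algebra_simps)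
    then show ?thesis by (simp add: power_mult_distrib psi_root_square[OF s])
  qed
  then have "a * ?v \<le> b * ?u"
    by (rule power2_le_imp_le) (use ab psi_root_ge_1[OF s, of a] in auto)
  then have "a * (1 + ?v) < b * (1 + ?u)" using ab by (simp add: algebra_simps)
  then show ?thesis
    using psi_root_ge_1[OF s, of a] psi_root_ge_1[OF s, of b]
    by (simp add: psi_scaled_deriv_def divide_simps algebra_simps)
qed

lemma profile_psi_scaled: "s > 0 \<Longrightarrow> profile (psi_scaled s) (psi_scaled_deriv s)"
  by unfold_locales
    (simp_all add: psi_scaled_has_deriv psi_scaled_deriv_strict_mono, simp_all add: psi_scaled_def psi_root_def psi_scaled_deriv_def)

lemma profile_square: "profile (\<lambda>t. t\<^sup>2) (\<lambda>t. 2 * t)"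
  by unfold_locales (auto intro!: derivative_eq_intros)

lemma ellipsoidal_class_psi_scaled:
  assumes s: "s > 0"
  shows "(ellipsoidal_class (psi (ennreal s)) :: (real^'n \<Rightarrow> real) set) = ellipsoidal_class (psi_scaled s)"
proof -
  have "psi (ennreal s) (sqrt (2 * s) * t) = psi_scaled s t" for t
  proof -
    have "4 * (sqrt (2 * s) * t / s)\<^sup>2 = 8 * t\<^sup>2 / s"
      using s by (simp add: power_divide power_mult_distrib) (simp add: power2_eq_square)
    then show ?thesis using s by (simp add: psi_def psi_scaled_def psi_root_def Let_def)
  qed
  then have "psi_scaled s = (\<lambda>t. psi (ennreal s) (sqrt (2 * s) * t))" by auto
  then show ?thesis using ellipsoidal_class_rescale[of "sqrt (2 * s)" "psi (ennreal s)", where 'n='n] s by simp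
qed

lemma psi_infinity: "psi \<infinity> = (\<lambda>t. t\<^sup>2)"
  by (auto simp: psi_def)

section \<open>Comparison of the rescaled profiles with each other and with the square\<close>

lemma le_of_deriv_le:
  fixes g h :: "real \<Rightarrow> real"
  assumes "\<And>x. (g has_real_derivative g' x) (at x)" "\<And>x. (h has_real_derivative h' x) (at x)"
    and "\<And>x. 0 \<le> x \<Longrightarrow> g' x \<le> h' x" "g 0 \<le> h 0" "0 \<le> t"
  shows "g t \<le> h t"
proof -
  have "h 0 - g 0 \<le> h t - g t"
  proof (rule DERIV_nonneg_imp_nondecreasing[OF assms(5)])
    fix x :: real assume "0 \<le> x" "x \<le> t"
    then show "\<exists>y. ((\<lambda>x. h x - g x) has_real_derivative y) (at x) \<and> 0 \<le> y"
      using assms(1-3)[of x] by (intro exI[of _ "h' x - g' x"]) (auto intro!: derivative_intros)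
  qed
  then show ?thesis using assms(4) by simp
qed

lemma psi_scaled_0 [simp]: "psi_scaled s 0 = 0"
  by (simp add: psi_scaled_def psi_root_def)

lemma psi_scaled_mono:
  assumes "0 < s" "s \<le> s'" "0 \<le> t"
  shows "psi_scaled s t \<le> psi_scaled s' t"
proof (rule le_of_deriv_le[OF psi_scaled_has_deriv psi_scaled_has_deriv])
  fix x :: real assume x: "0 \<le> x"
  have "8 * x\<^sup>2 / s' \<le> 8 * x\<^sup>2 / s" using assms by (intro divide_left_mono) auto
  then have "psi_root s' x \<le> psi_root s x" by (simp add: psi_root_def)
  moreover have "0 < psi_root s' x" using psi_root_ge_1[of s' x] assms by simp
  ultimately show "psi_scaled_deriv s x \<le> psi_scaled_deriv s' x"
    unfolding psi_scaled_deriv_def using x by (intro divide_left_mono mult_pos_pos) auto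
qed (use assms in auto)

lemma psi_scaled_minus: "psi_scaled s (- t) = psi_scaled s t"
  by (simp add: psi_scaled_def psi_root_def)

lemma psi_scaled_le_square:
  assumes "s > 0" shows "psi_scaled s t \<le> t\<^sup>2"
proof -
  have *: "psi_scaled s t \<le> t\<^sup>2" if "0 \<le> t" for t
  proof (rule le_of_deriv_le[OF psi_scaled_has_deriv[OF assms], of "\<lambda>t. t\<^sup>2" "\<lambda>t. 2 * t"])
    fix x :: real assume x: "0 \<le> x"
    have "2 \<le> 1 + psi_root s x" using psi_root_ge_1[OF assms, of x] by simp
    then have "4 * x / (1 + psi_root s x) \<le> 4 * x / 2" using x by (intro divide_left_mono) auto
    then show "psi_scaled_deriv s x \<le> 2 * x" by (simp add: psi_scaled_deriv_def)
  qed (use that in \<open>auto intro!: derivative_eq_intros\<close>)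
  show ?thesis using *[of t] *[of "- t"] by (cases "0 \<le> t") (auto simp: psi_scaled_minus)
qed

text \<open>By sqrt (1 + 2 u) \<le> 1 + u with u = 4 x^2 / s the root exceeds 1 by at most 4 x^2 /
  s. The derivatives then differ by at most 4 x^3 / s, which integrates to the error term. The error
  is small uniformly on bounded sets, as convergence at moving arguments requires.\<close>

lemma square_le_psi_scaled:
  assumes "s > 0" shows "t\<^sup>2 \<le> psi_scaled s t + t ^ 4 / s"
proof -
  have *: "t\<^sup>2 \<le> psi_scaled s t + t ^ 4 / s" if "0 \<le> t" for t
  proof (rule le_of_deriv_le[of "\<lambda>t. t\<^sup>2" "\<lambda>t. 2 * t" _ "\<lambda>t. psi_scaled_deriv s t + 4 * t ^ 3 / s"])
    fix x :: real
    show "((\<lambda>t. psi_scaled s t + t ^ 4 / s) has_real_derivative psi_scaled_deriv s x + 4 * x ^ 3 / s) (at x)"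
      using assms by (auto intro!: derivative_eq_intros psi_scaled_has_deriv)
    assume x: "0 \<le> x"
    define w where "w = psi_root s x"
    have w: "w \<ge> 1" using psi_root_ge_1[OF assms, of x] by (simp add: w_def)
    have "1 + 8 * x\<^sup>2 / s \<le> (1 + 4 * x\<^sup>2 / s)\<^sup>2" by (simp add: power2_sum)
    then have "w \<le> 1 + 4 * x\<^sup>2 / s"
      unfolding w_def psi_root_def using assms by (intro real_le_lsqrt) auto
    then have "x * (w - 1) \<le> x * (4 * x\<^sup>2 / s)" using x by (intro mult_left_mono) auto
    then have c: "x * (w - 1) \<le> 4 * x ^ 3 / s" by (simp add: power2_eq_square power3_eq_cube mult.assoc mult.left_commute)
    have "2 * x - 4 * x / (1 + w) = 2 * (x * (w - 1)) / (1 + w)"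
      using w by (simp add: field_simps)
    also have "\<dots> \<le> 2 * (x * (w - 1)) / 2"
      using w x by (intro divide_left_mono) auto
    finally show "2 * x \<le> psi_scaled_deriv s x + 4 * x ^ 3 / s"
      using c by (simp add: psi_scaled_deriv_def w_def)
  qed (use that in \<open>auto intro!: derivative_eq_intros\<close>)
  show ?thesis using *[of t] *[of "- t"] by (cases "0 \<le> t") (auto simp: psi_scaled_minus)
qed

text \<open>The root grows linearly, so the derivative stays bounded; the constant is not sharp.
  Linear growth is what lets an exponentially decaying \<open>f\<close> have a majorant for every
  finite s, whereas a Gaussian majorant may fail to exist.\<close>

lemma psi_scaled_le_linear:
  assumes s: "s > 0" and t: "0 \<le> t"
  shows "psi_scaled s t \<le> 2 * sqrt s * t"
proof (rule le_of_deriv_le[OF psi_scaled_has_deriv[OF s], of "\<lambda>t. 2 * sqrt s * t" "\<lambda>t. 2 * sqrt s"])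
  fix x :: real assume x: "0 \<le> x"
  have "(2 * x)\<^sup>2 \<le> (sqrt s * psi_root s x)\<^sup>2"
    using s by (simp add: power_mult_distrib psi_root_square algebra_simps)
  then have "2 * x \<le> sqrt s * psi_root s x"
    by (rule power2_le_imp_le) (use s psi_root_ge_1[OF s, of x] in auto)
  also have "\<dots> \<le> sqrt s * (1 + psi_root s x)" using s by simp
  finally show "psi_scaled_deriv s x \<le> 2 * sqrt s"
    using psi_root_ge_1[OF s, of x] by (simp add: psi_scaled_deriv_def pos_divide_le_eq)
qed (use t in \<open>auto intro!: derivative_eq_intros\<close>)

lemma psi_scaled_tendsto_square:
  assumes s: "filterlim s at_top sequentially" "\<And>k. s k > 0" and t: "t \<longlonglongrightarrow> t0"
  shows "(\<lambda>k. psi_scaled (s k) (t k)) \<longlonglongrightarrow> t0\<^sup>2"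
proof -
  have "(\<lambda>k. t k ^ 4 / s k) \<longlonglongrightarrow> 0"
    by (rule tendsto_divide_0[OF tendsto_power[OF t] filterlim_at_top_imp_at_infinity[OF s(1)]])
  then have l1: "(\<lambda>k. (t k)\<^sup>2 - t k ^ 4 / s k) \<longlonglongrightarrow> t0\<^sup>2"
    using tendsto_diff[OF tendsto_power[OF t, of 2]] by fastforce
  have l2: "(\<lambda>k. (t k)\<^sup>2) \<longlonglongrightarrow> t0\<^sup>2" by (rule tendsto_power[OF t])
  have e1: "\<forall>\<^sub>F k in sequentially. (t k)\<^sup>2 - t k ^ 4 / s k \<le> psi_scaled (s k) (t k)"
  proof (rule always_eventually, rule allI)
    show "(t k)\<^sup>2 - t k ^ 4 / s k \<le> psi_scaled (s k) (t k)" for k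
      using square_le_psi_scaled[OF s(2), of "t k" k] by simp
  qed
  have e2: "\<forall>\<^sub>F k in sequentially. psi_scaled (s k) (t k) \<le> (t k)\<^sup>2"
    by (rule always_eventually, rule allI) (rule psi_scaled_le_square[OF s(2)])
  show ?thesis by (rule tendsto_sandwich[OF e1 e2 l1 l2])
qed

section \<open>Convergence to the Gaussian problem\<close>

text \<open>With \<open>L\<close> bounding the inverse of the limit, a perturbation of operator norm
  below 1 / (2 L) uses up at most half of |x|; hence the constant 2 L.\<close>

lemma norm_le_invertible_perturbation:
  fixes A :: "nat \<Rightarrow> real^'n^'n"
  assumes lim: "A \<longlonglongrightarrow> A'" and inv: "invertible A'"
  obtains L where "L > 0" "\<forall>\<^sub>F k in sequentially. \<forall>x. norm x \<le> L * norm (A k *v x)"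
proof -
  define n where "n = real CARD('n)"
  have n: "n > 0" by (simp add: n_def)
  obtain B where B: "B ** A' = mat 1" using inv by (auto simp: invertible_def)
  define L where "L = n * norm B + 1"
  have L: "L > 0" using n by (simp add: L_def add_nonneg_pos)
  have "(\<lambda>k. n * norm (A k - A')) \<longlonglongrightarrow> n * norm (A' - A')"
    by (intro tendsto_intros lim)
  then have "\<forall>\<^sub>F k in sequentially. n * norm (A k - A') < 1 / (2 * L)"
    using L by (auto dest!: order_tendstoD(2)[of _ _ _ "1 / (2 * L)"])
  then have "\<forall>\<^sub>F k in sequentially. \<forall>x. norm x \<le> (2 * L) * norm (A k *v x)"
  proof (eventually_elim, intro allI)
    fix k x assume k: "n * norm (A k - A') < 1 / (2 * L)"
    have "norm x = norm (B *v (A' *v x))" by (simp add: matrix_vector_mul_assoc B)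
    also have "\<dots> \<le> n * norm B * norm (A' *v x)"
      unfolding n_def by (rule norm_matrix_vector_le)
    also have "\<dots> \<le> L * norm (A' *v x)" by (intro mult_right_mono) (auto simp: L_def)
    also have "A' *v x = A k *v x - (A k - A') *v x" by (simp add: matrix_vector_mult_diff_rdistrib)
    also have "norm \<dots> \<le> norm (A k *v x) + norm ((A k - A') *v x)" by (rule norm_triangle_ineq4)
    also have "norm ((A k - A') *v x) \<le> n * norm (A k - A') * norm x"
      unfolding n_def by (rule norm_matrix_vector_le)
    also have "n * norm (A k - A') * norm x \<le> 1 / (2 * L) * norm x"
      using k by (intro mult_right_mono) auto
    finally have "norm x \<le> L * (norm (A k *v x) + 1 / (2 * L) * norm x)" using L by simp
    also have "\<dots> = L * norm (A k *v x) + norm x / 2" using L by (simp add: distrib_left)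
    finally show "norm x \<le> (2 * L) * norm (A k *v x)" by simp
  qed
  with L show thesis by (intro that[of "2 * L"]) auto
qed

lemma ell_ge_imp_norm_le:
  assumes "\<kappa> > 0" "e > 0" "\<alpha> > 0" "\<alpha> \<le> a" and lin: "\<And>t. t \<ge> 0 \<Longrightarrow> \<kappa> * (t - 1) \<le> \<psi> t"
    and ge: "e \<le> ell \<psi> \<alpha> A b x"
  shows "norm (A *v x + b) \<le> 1 + ln (a / e) / \<kappa>"
proof -
  let ?p = "\<psi> (norm (A *v x + b))"
  have "e \<le> \<alpha> * exp (- ?p)" using ge by (simp add: ell_def)
  also have "\<dots> \<le> a * exp (- ?p)" using assms by simp
  finally have "e \<le> a * exp (- ?p)" .
  then have "exp ?p \<le> a / e" using assms by (simp add: exp_minus field_simps)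
  then have "?p \<le> ln (a / e)" using assms by (subst ln_ge_iff) auto
  then have "\<kappa> * (norm (A *v x + b) - 1) \<le> ln (a / e)" using lin[of "norm (A *v x + b)"] by simp
  then show ?thesis using assms by (simp add: field_simps)
qed

text \<open>Uniform convergence in sequential form. Both functions are non-negative, so where they
  differ by e one of them is at least e; the common linear bound and the uniform invertibility then
  bound x k. At a limit point of these points both values converge to the same number.\<close>

lemma ell_sequence_not_uniformly_far:
  fixes A :: "nat \<Rightarrow> real^'n^'n"
  assumes \<kappa>: "\<kappa> > 0" and e: "e > 0"
    and \<alpha>: "\<And>k. \<alpha> k > 0" "\<alpha> \<longlonglongrightarrow> \<alpha>'" "\<alpha>' > 0" and A: "A \<longlonglongrightarrow> A'" "invertible A'" and b: "b \<longlonglongrightarrow> b'"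
    and lin: "\<And>k t. t \<ge> 0 \<Longrightarrow> \<kappa> * (t - 1) \<le> \<psi> k t" "\<And>t. t \<ge> 0 \<Longrightarrow> \<kappa> * (t - 1) \<le> \<psi>' t"
    and conv: "\<And>t t0 (\<sigma> :: nat \<Rightarrow> nat). strict_mono \<sigma> \<Longrightarrow> t \<longlonglongrightarrow> t0 \<Longrightarrow> (\<lambda>k. \<psi> (\<sigma> k) (t k)) \<longlonglongrightarrow> \<psi>' t0"
    and cont: "\<And>t. isCont \<psi>' t"
  shows "\<exists>k. dist (ell (\<psi> k) (\<alpha> k) (A k) (b k) (x k)) (ell \<psi>' \<alpha>' A' b' (x k)) < e"
proof (rule ccontr)
  assume "\<not> ?thesis"
  then have far: "e \<le> dist (ell (\<psi> k) (\<alpha> k) (A k) (b k) (x k)) (ell \<psi>' \<alpha>' A' b' (x k))" for k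
    by (simp add: not_less)
  obtain L where L: "L > 0" "\<forall>\<^sub>F k in sequentially. \<forall>x. norm x \<le> L * norm (A k *v x)"
    by (rule norm_le_invertible_perturbation[OF A]) (rule that)
  obtain L' where L': "L' > 0" "\<forall>\<^sub>F k in (sequentially :: nat filter). \<forall>x. norm x \<le> L' * norm (A' *v x)"
    by (rule norm_le_invertible_perturbation[OF tendsto_const A(2)]) (rule that)
  have L'x: "norm x \<le> L' * norm (A' *v x)" for x using L'(2) by simp
  obtain k0 where k0: "\<And>k x. k \<ge> k0 \<Longrightarrow> norm x \<le> L * norm (A k *v x)"
    using L(2) by (auto simp: eventually_sequentially)
  obtain a where a: "\<And>k. \<alpha> k \<le> a"
    using Bseq_bdd_above[OF convergent_imp_Bseq[OF convergentI[OF \<alpha>(2)]]] by (auto simp: bdd_above_def)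
  have a': "\<alpha>' \<le> a" using a by (intro tendsto_upperbound[OF \<alpha>(2)]) auto
  obtain \<beta> where \<beta>: "\<And>k. norm (b k) \<le> \<beta>"
    using convergent_imp_Bseq[OF convergentI[OF b]] by (auto simp: Bseq_def)
  have \<beta>': "norm b' \<le> \<beta>" using \<beta> by (intro tendsto_upperbound[OF tendsto_norm[OF b]]) auto
  define Y where "Y = 1 + ln (a / e) / \<kappa>"
  have bound: "norm (x k) \<le> max L L' * \<bar>Y + \<beta>\<bar>" if "k \<ge> k0" for k
  proof -
    let ?p = "ell (\<psi> k) (\<alpha> k) (A k) (b k) (x k)" and ?q = "ell \<psi>' \<alpha>' A' b' (x k)"
    have "?p \<ge> 0" "?q \<ge> 0" using \<alpha>(1)[of k] \<alpha>(3) by (auto simp: ell_def)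
    then have "e \<le> ?p \<or> e \<le> ?q" using far[of k] by (auto simp: dist_real_def)
    then show ?thesis
    proof
      assume "e \<le> ?p"
      from ell_ge_imp_norm_le[OF \<kappa> e \<alpha>(1) a lin(1) this]
      have "norm (A k *v x k + b k) \<le> Y" by (simp add: Y_def)
      then have "norm (A k *v x k) \<le> Y + \<beta>"
        using norm_triangle_ineq4[of "A k *v x k + b k" "b k"] \<beta>[of k] by simp
      then have "norm (A k *v x k) \<le> \<bar>Y + \<beta>\<bar>" by linarith
      then have "L * norm (A k *v x k) \<le> max L L' * \<bar>Y + \<beta>\<bar>" using L by (intro mult_mono) auto
      with k0[OF that, of "x k"] show ?thesis by linarith
    next
      assume "e \<le> ?q"
      from ell_ge_imp_norm_le[OF \<kappa> e \<alpha>(3) a' lin(2) this]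
      have "norm (A' *v x k + b') \<le> Y" by (simp add: Y_def)
      then have "norm (A' *v x k) \<le> Y + \<beta>"
        using norm_triangle_ineq4[of "A' *v x k + b'" b'] \<beta>' by simp
      then have "norm (A' *v x k) \<le> \<bar>Y + \<beta>\<bar>" by linarith
      then have "L' * norm (A' *v x k) \<le> max L L' * \<bar>Y + \<beta>\<bar>" using L' by (intro mult_mono) auto
      with L'x[of "x k"] show ?thesis by linarith
    qed
  qed
  \<comment> \<open>The estimate holds only from \<open>k0\<close> on, hence the shifted
    sequence.\<close>
  have bnd: "bounded (range (\<lambda>k. x (k + k0)))"
    unfolding bounded_iff by (intro exI[of _ "max L L' * \<bar>Y + \<beta>\<bar>"]) (auto intro: bound)
  obtain y \<tau> where \<tau>: "strict_mono (\<tau> :: nat \<Rightarrow> nat)" and y: "((\<lambda>k. x (k + k0)) \<circ> \<tau>) \<longlonglongrightarrow> y"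
    using bounded_imp_convergent_subsequence[OF bnd] by blast
  define \<sigma> where "\<sigma> k = \<tau> k + k0" for k
  have \<sigma>: "strict_mono \<sigma>" using \<tau> by (simp add: \<sigma>_def strict_mono_def)
  have xl: "(\<lambda>k. x (\<sigma> k)) \<longlonglongrightarrow> y" using y by (simp add: o_def \<sigma>_def)
  have sub: "(\<lambda>k. g (\<sigma> k)) \<longlonglongrightarrow> l" if "g \<longlonglongrightarrow> l" for g :: "nat \<Rightarrow> 'c::topological_space" and l
    using LIMSEQ_subseq_LIMSEQ[OF that \<sigma>] by (simp add: o_def)
  have "(\<lambda>k. dist (ell (\<psi> (\<sigma> k)) (\<alpha> (\<sigma> k)) (A (\<sigma> k)) (b (\<sigma> k)) (x (\<sigma> k))) (ell \<psi>' \<alpha>' A' b' (x (\<sigma> k))))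
      \<longlonglongrightarrow> dist (ell \<psi>' \<alpha>' A' b' y) (ell \<psi>' \<alpha>' A' b' y)"
    unfolding ell_def
    by (intro tendsto_intros conv \<sigma> sub[OF \<alpha>(2)] sub[OF A(1)] sub[OF b] xl isCont_tendsto_compose[OF cont])
  then have "e \<le> dist (ell \<psi>' \<alpha>' A' b' y) (ell \<psi>' \<alpha>' A' b' y)"
    by (rule tendsto_lowerbound) (use far in auto)
  with e show False by simp
qed

interpretation square: profile "\<lambda>t. t\<^sup>2" "\<lambda>t. 2 * t"
  by (rule profile_square)

lemma solves_loewner_problem_infinity_iff:
  "solves_loewner_problem \<infinity> f l \<longleftrightarrow> (\<exists>\<alpha> A b. optimal (\<lambda>t. t\<^sup>2) f \<alpha> A b \<and> l = ell (\<lambda>t. t\<^sup>2) \<alpha> A b)"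
  by (rule square.solves_loewner_problem_iff) (simp only: psi_infinity)

lemma ell_square_le_psi_scaled:
  assumes "s > 0" "\<alpha> > 0"
  shows "ell (\<lambda>t. t\<^sup>2) \<alpha> A b \<le> ell (psi_scaled s) \<alpha> A b"
  using assms psi_scaled_le_square[OF assms(1)] by (simp add: le_fun_def ell_def)

lemma psi_scaled_linear_lower_bound:
  assumes "s \<ge> 1" "t \<ge> 0"
  shows "psi_scaled 1 1 * (t - 1) \<le> psi_scaled s t"
  using profile.linear_lower_bound[OF profile_psi_scaled[of 1], of t] psi_scaled_mono[of 1 s t] assms by simp

lemma mass_psi_scaled_antimono:
  assumes "0 < s" "s \<le> s'"
  shows "profile.mass (psi_scaled s') TYPE('m::finite) \<le> profile.mass (psi_scaled s) TYPE('m)"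
  unfolding profile.mass_def[OF profile_psi_scaled[OF assms(1)]] profile.mass_def[OF profile_psi_scaled[OF less_le_trans[OF assms]]]
  by (intro nn_integral_mono ennreal_leI) (simp add: psi_scaled_mono[OF assms])

lemma mass_square_le_psi_scaled:
  assumes "0 < s"
  shows "square.mass TYPE('m::finite) \<le> profile.mass (psi_scaled s) TYPE('m)"
  unfolding profile.mass_def[OF profile_psi_scaled[OF assms(1)]] square.mass_def
  by (intro nn_integral_mono ennreal_leI) (simp add: psi_scaled_le_square[OF assms])

text \<open>\<open>loewner_function\<close> is a definite description, so nothing is known of it
  before existence and uniqueness. A feasible point for \<open>optimal_exists\<close> comes from the
  exponential decay of \<open>f\<close>.\<close>

lemma loewner_function_optimal:
  fixes f :: "real^'n \<Rightarrow> real"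
  assumes usc: "upper_semicontinuous f" and lc: "log_concave f"
    and pos: "0 < (\<integral>\<^sup>+x. ennreal (f x) \<partial>lborel)" and fin: "(\<integral>\<^sup>+x. ennreal (f x) \<partial>lborel) < \<infinity>"
    and s: "s > 0"
  shows "\<exists>\<alpha> A b. optimal (psi_scaled s) f \<alpha> A b \<and> loewner_function s f = ell (psi_scaled s) \<alpha> A b"
proof -
  interpret profile "psi_scaled s" "psi_scaled_deriv s" by (rule profile_psi_scaled[OF s])
  note iff = solves_loewner_problem_iff[OF ellipsoidal_class_psi_scaled[OF s], of f]
  obtain \<rho> x0 r where ball: "\<rho> > 0" "r > 0" "\<forall>x\<in>cball x0 r. \<rho> \<le> f x"
    by (rule log_concave_ge_on_ball[OF usc lc pos]) (rule that)
  obtain C c where C: "C > 0" "c > 0" "\<And>x. f x \<le> C * exp (- c * norm (x - x0))"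
    by (rule log_concave_exponential_decay[OF usc lc fin ball]) (rule that)
  \<comment> \<open>Chosen so that the bound 2 sqrt s t on the profile, at t = k |x - x0|, is
    exactly c |x - x0|.\<close>
  define k where "k = c / (2 * sqrt s)"
  have k: "k > 0" using C s by (simp add: k_def)
  have "f x \<le> ell (psi_scaled s) C (k *\<^sub>R mat 1) (- k *\<^sub>R x0) x" for x
  proof -
    have "(k *\<^sub>R mat 1) *v x + (- k) *\<^sub>R x0 = k *\<^sub>R (x - x0)"
      by (simp add: scaleR_matrix_vector_assoc[symmetric] algebra_simps)
    then have "norm ((k *\<^sub>R mat 1) *v x + (- k) *\<^sub>R x0) = k * norm (x - x0)" using k by simp
    moreover have "psi_scaled s (k * norm (x - x0)) \<le> 2 * sqrt s * (k * norm (x - x0))"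
      using k by (intro psi_scaled_le_linear[OF s]) auto
    then have "psi_scaled s (k * norm (x - x0)) \<le> c * norm (x - x0)" using s by (simp add: k_def)
    ultimately show ?thesis using C(1) by (intro order_trans[OF C(3)]) (simp add: ell_def)
  qed
  moreover have "invertible (k *\<^sub>R mat 1 :: real^'n^'n)" using k by (simp add: invertible_det_nz det_scaleR)
  ultimately obtain \<alpha> A b where o: "optimal (psi_scaled s) f \<alpha> A b"
    using optimal_exists[OF ball C(1)] by (metis le_funI)
  have "\<exists>!l. solves_loewner_problem (ennreal s) f l"
    unfolding iff using o optimal_unique by (intro ex_ex1I) blast+
  then have "solves_loewner_problem (ennreal s) f (loewner_function s f)"
    unfolding loewner_function_def by (rule theI')
  then show ?thesis by (simp add: iff)
qed

lemma gaussian_limit: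
  fixes f :: "real^'n \<Rightarrow> real" and A :: "nat \<Rightarrow> real^'n^'n"
  assumes ball: "\<rho> > 0" "r > 0" "\<forall>x\<in>cball x0 r. \<rho> \<le> f x"
    and s: "filterlim s at_top sequentially" "\<And>k. s k \<ge> 1"
    and opt: "\<And>k. optimal (psi_scaled (s k)) f (\<alpha> k) (A k) (b k)"
    and ratio: "\<And>k. \<alpha> k / \<bar>det (A k)\<bar> \<le> M"
  obtains \<sigma> \<alpha>' A' b' where "strict_mono (\<sigma> :: nat \<Rightarrow> nat)"
    "(\<lambda>k. \<alpha> (\<sigma> k)) \<longlonglongrightarrow> \<alpha>'" "(\<lambda>k. A (\<sigma> k)) \<longlonglongrightarrow> A'" "(\<lambda>k. b (\<sigma> k)) \<longlonglongrightarrow> b'"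
    "\<alpha>' > 0" "invertible A'" "f \<le> ell (\<lambda>t. t\<^sup>2) \<alpha>' A' b'"
proof -
  have s0: "s k > 0" for k using s(2)[of k] by simp
  have p: "\<alpha> k > 0" "invertible (A k)" "f \<le> ell (psi_scaled (s k)) (\<alpha> k) (A k) (b k)" for k
    using opt[of k] by (auto simp: optimal_def)
  show thesis
  proof (rule feasible_subsequence[OF profile.one_pos[OF profile_psi_scaled[of 1]] ball p(1,2) ratio p(3)])
    show "(\<lambda>k. psi_scaled (s (\<sigma> k)) (t k)) \<longlonglongrightarrow> t0\<^sup>2" if "strict_mono \<sigma>" "t \<longlonglongrightarrow> t0" for t t0 and \<sigma> :: "nat \<Rightarrow> nat"
      using that s0 by (intro psi_scaled_tendsto_square filterlim_compose[OF s(1)] filterlim_subseq)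
  qed (use that in \<open>auto intro: psi_scaled_linear_lower_bound s profile.nonneg[OF profile_psi_scaled[OF s0]]\<close>)
qed

lemma gaussian_density_iff:
  "gaussian_density G \<longleftrightarrow> (\<exists>\<alpha> A b. \<alpha> > 0 \<and> invertible A \<and> G = ell (\<lambda>t. t\<^sup>2) \<alpha> A b)"
  unfolding gaussian_density_def psi_infinity ellipsoidal_class_eq by blast

lemma optimal_psi_scaled_le_gaussian:
  assumes "s > 0" "optimal (psi_scaled s) f \<alpha> A b"
    and "\<alpha>' > 0" "invertible A'" "f \<le> ell (\<lambda>t. t\<^sup>2) \<alpha>' A' b'"
  shows "\<alpha> / \<bar>det A\<bar> \<le> \<alpha>' / \<bar>det A'\<bar>"
  using assms order_trans[OF assms(5) ell_square_le_psi_scaled[OF assms(1,3)]]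
  unfolding optimal_def by blast

text \<open>The parameters themselves need not converge, because of the orthogonal freedom. Instead
  a sequence of s on which the functions stay away from the Gaussian is refined until the parameters
  converge; the limit is optimal, hence by uniqueness the same Gaussian as a function.\<close>

lemma loewner_functions_uniform_limit:
  fixes f :: "real^'n \<Rightarrow> real"
  assumes usc: "upper_semicontinuous f" and lc: "log_concave f"
    and pos: "0 < (\<integral>\<^sup>+x. ennreal (f x) \<partial>lborel)" and fin: "(\<integral>\<^sup>+x. ennreal (f x) \<partial>lborel) < \<infinity>"
    and o: "optimal (\<lambda>t. t\<^sup>2) f \<alpha>0 A0 b0"
  shows "uniform_limit UNIV (\<lambda>s. loewner_function s f) (ell (\<lambda>t. t\<^sup>2) \<alpha>0 A0 b0) at_top"
proof (rule ccontr)
  let ?l = "ell (\<lambda>t. t\<^sup>2) \<alpha>0 A0 b0"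
  assume "\<not> ?thesis"
  then obtain e where e: "e > 0" and "\<not> (\<forall>\<^sub>F s in at_top. \<forall>x. dist (loewner_function s f x) (?l x) < e)"
    unfolding uniform_limit_iff by auto
  \<comment> \<open>The bound k + 1 makes s tend to infinity and also keeps s \<ge> 1, the range of
    the common linear lower bound.\<close>
  then have "\<exists>s\<ge>real k + 1. \<exists>x. \<not> dist (loewner_function s f x) (?l x) < e" for k :: nat
    unfolding eventually_at_top_linorder by blast
  then obtain s x where s: "\<And>k::nat. s k \<ge> real k + 1"
    and far: "\<And>k. \<not> dist (loewner_function (s k) f (x k)) (?l (x k)) < e" by metis
  have s1: "s k \<ge> 1" and s0: "s k > 0" for k using s[of k] by linarith+
  have slim: "filterlim s at_top sequentially"
    by (rule filterlim_at_top_mono[OF filterlim_real_sequentially always_eventually]) (rule allI, rule order_trans[OF _ s], simp)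
  have "\<exists>\<alpha> A b. optimal (psi_scaled (s k)) f \<alpha> A b \<and> loewner_function (s k) f = ell (psi_scaled (s k)) \<alpha> A b" for k
    by (rule loewner_function_optimal[OF usc lc pos fin s0])
  then obtain \<alpha> A b where opt: "\<And>k. optimal (psi_scaled (s k)) f (\<alpha> k) (A k) (b k)"
    and eq: "\<And>k. loewner_function (s k) f = ell (psi_scaled (s k)) (\<alpha> k) (A k) (b k)" by metis
  have o': "\<alpha>0 > 0" "invertible A0" "f \<le> ?l" using o by (auto simp: optimal_def)
  obtain \<rho> x0 r where ball: "\<rho> > 0" "r > 0" "\<forall>x\<in>cball x0 r. \<rho> \<le> f x"
    by (rule log_concave_ge_on_ball[OF usc lc pos]) (rule that)
  obtain \<sigma> \<alpha>' A' b' where \<sigma>: "strict_mono (\<sigma> :: nat \<Rightarrow> nat)"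
    and lim: "(\<lambda>k. \<alpha> (\<sigma> k)) \<longlonglongrightarrow> \<alpha>'" "(\<lambda>k. A (\<sigma> k)) \<longlonglongrightarrow> A'" "(\<lambda>k. b (\<sigma> k)) \<longlonglongrightarrow> b'"
    and feas: "\<alpha>' > 0" "invertible A'" "f \<le> ell (\<lambda>t. t\<^sup>2) \<alpha>' A' b'"
    by (rule gaussian_limit[OF ball slim s1 opt optimal_psi_scaled_le_gaussian[OF s0 opt o']]) (rule that)
  have d0: "det A' \<noteq> 0" using feas by (simp add: invertible_det_nz)
  have "optimal (\<lambda>t. t\<^sup>2) f \<alpha>' A' b'"
    unfolding optimal_def
  proof (intro conjI allI impI feas)
    fix \<alpha>2 A2 b2 assume c: "\<alpha>2 > 0" "invertible A2" "f \<le> ell (\<lambda>t. t\<^sup>2) \<alpha>2 A2 b2"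
    have "(\<lambda>k. \<alpha> (\<sigma> k) / \<bar>det (A (\<sigma> k))\<bar>) \<longlonglongrightarrow> \<alpha>' / \<bar>det A'\<bar>"
      using d0 by (intro tendsto_intros lim) auto
    then show "\<alpha>' / \<bar>det A'\<bar> \<le> \<alpha>2 / \<bar>det A2\<bar>"
      by (rule tendsto_upperbound) (auto intro!: always_eventually optimal_psi_scaled_le_gaussian[OF s0 opt c])
  qed
  then have l: "?l = ell (\<lambda>t. t\<^sup>2) \<alpha>' A' b'" by (rule square.optimal_unique[OF o])
  have "\<exists>k. dist (ell (psi_scaled (s (\<sigma> k))) (\<alpha> (\<sigma> k)) (A (\<sigma> k)) (b (\<sigma> k)) (x (\<sigma> k))) (ell (\<lambda>t. t\<^sup>2) \<alpha>' A' b' (x (\<sigma> k))) < e"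
  proof (rule ell_sequence_not_uniformly_far[OF profile.one_pos[OF profile_psi_scaled[of 1]] e _ lim(1) feas(1) lim(2) feas(2) lim(3)])
    show "0 < \<alpha> (\<sigma> k)" for k using opt by (auto simp: optimal_def)
    show "psi_scaled 1 1 * (t - 1) \<le> psi_scaled (s (\<sigma> k)) t" if "0 \<le> t" for k t
      using that by (rule psi_scaled_linear_lower_bound[OF s1])
    show "psi_scaled 1 1 * (t - 1) \<le> t\<^sup>2" if "0 \<le> t" for t
      using psi_scaled_linear_lower_bound[OF order_refl that] psi_scaled_le_square[of 1 t] by simp
    show "(\<lambda>k. psi_scaled (s (\<sigma> (\<tau> k))) (t k)) \<longlonglongrightarrow> t0\<^sup>2" if "strict_mono \<tau>" "t \<longlonglongrightarrow> t0" for t t0 and \<tau> :: "nat \<Rightarrow> nat"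
      using that s0
      by (intro psi_scaled_tendsto_square filterlim_compose[OF slim] filterlim_compose[OF filterlim_subseq[OF \<sigma>]] filterlim_subseq)
  qed (auto intro: continuous_intros)
  with far show False by (auto simp: eq l)
qed

text \<open>A finite lower limit controls the integrals only along some sequence of s, which is all
  that compactness asks for. Conversely, a Gaussian majorant bounds the integrals for all s \<ge> 1.
  Assertion (3) returns to (2) because a solution is itself a Gaussian majorant.\<close>

theorem theorem1p4:
  fixes f :: "real ^ 'n \<Rightarrow> real"
  assumes nonneg: "\<And>x. 0 \<le> f x"
    and usc: "upper_semicontinuous f"
    and log_concave: "log_concave f"
    and pos_integral: "0 < (\<integral>\<^sup>+ x. ennreal (f x) \<partial>lborel)"
    and finite_integral: "(\<integral>\<^sup>+ x. ennreal (f x) \<partial>lborel) < \<infinity>"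
  defines "assertion1 \<equiv>
      Liminf at_top (\<lambda>s :: real. \<integral>\<^sup>+ x. ennreal (loewner_function s f x) \<partial>lborel) < \<infinity>"
    and "assertion2 \<equiv> (\<exists>G. gaussian_density G \<and> f \<le> G)"
    and "assertion3 \<equiv>
      (\<exists>!l. solves_loewner_problem \<infinity> f l) \<and>
      (\<forall>l. solves_loewner_problem \<infinity> f l \<longrightarrow>
        uniform_limit UNIV (\<lambda>s. loewner_function s f) l at_top)"
  shows "(assertion1 \<longleftrightarrow> assertion2) \<and> (assertion2 \<longleftrightarrow> assertion3)"
proof -
  note opt = loewner_function_optimal[OF usc log_concave pos_integral finite_integral]
  let ?I = "\<lambda>s. \<integral>\<^sup>+ x. ennreal (loewner_function s f x) \<partial>lborel"
  obtain \<rho> x0 r where ball: "\<rho> > 0" "r > 0" "\<forall>x\<in>cball x0 r. \<rho> \<le> f x"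
    by (rule log_concave_ge_on_ball[OF usc log_concave pos_integral]) (rule that)
  have 12: assertion2 if assertion1
  proof -
    have "Liminf at_top ?I < \<infinity>" using that by (simp add: assertion1_def)
    \<comment> \<open>A level y below the finite \<open>J\<close> is not eventually exceeded, so the
      integrals are at most y for arbitrarily large s.\<close>
    then obtain J where "Liminf at_top ?I < J" "J < \<infinity>" using dense by blast
    then obtain y where y: "y < J" "\<not> (\<forall>\<^sub>F s in at_top. y < ?I s)"
      using le_Liminf_iff[of J at_top ?I] by (auto simp: not_le)
    then have "\<exists>s\<ge>real k + 1. \<not> y < ?I s" for k :: nat
      unfolding eventually_at_top_linorder by blast
    then obtain s where s: "\<And>k::nat. s k \<ge> real k + 1" and Iy: "\<And>k. ?I (s k) \<le> y" by (metis not_less)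
    have s1: "s k \<ge> 1" and s0: "s k > 0" for k using s[of k] by linarith+
    have slim: "filterlim s at_top sequentially"
      by (rule filterlim_at_top_mono[OF filterlim_real_sequentially always_eventually]) (rule allI, rule order_trans[OF _ s], simp)
    obtain \<alpha> A b where o: "\<And>k. optimal (psi_scaled (s k)) f (\<alpha> k) (A k) (b k)"
      and eq: "\<And>k. loewner_function (s k) f = ell (psi_scaled (s k)) (\<alpha> k) (A k) (b k)"
      using opt[OF s0] by metis
    have p: "\<alpha> k > 0" "invertible (A k)" for k using o[of k] by (auto simp: optimal_def)
    obtain m where m: "square.mass TYPE('n) = ennreal m" "m > 0"
      using square.mass_finite[where 'm='n] square.mass_pos[where 'm='n] by (cases "square.mass TYPE('n)") auto
    obtain i where i: "y = ennreal i" "i \<ge> 0" using y \<open>J < \<infinity>\<close> by (cases y) auto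
    \<comment> \<open>The constant of the profile at s k is at least the Gaussian constant
      \<open>m\<close>, so the bound \<open>i\<close> on the integrals bounds the ratios
      independently of k.\<close>
    have ratio: "\<alpha> k / \<bar>det (A k)\<bar> \<le> i / m" for k
    proof -
      have "ennreal (\<alpha> k / \<bar>det (A k)\<bar> * m) = ennreal (\<alpha> k / \<bar>det (A k)\<bar>) * square.mass TYPE('n)"
        unfolding m by (rule ennreal_mult) (use p[of k] m in auto)
      also have "\<dots> \<le> ennreal (\<alpha> k / \<bar>det (A k)\<bar>) * profile.mass (psi_scaled (s k)) TYPE('n)"
        by (intro mult_left_mono mass_square_le_psi_scaled s0) auto
      also have "\<dots> = ?I (s k)"
        unfolding eq by (rule profile.nn_integral_ell[OF profile_psi_scaled[OF s0] p(2,1), symmetric])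
      also have "\<dots> \<le> ennreal i" using Iy[of k] i by simp
      finally have "\<alpha> k / \<bar>det (A k)\<bar> * m \<le> i" using i by (simp add: ennreal_le_iff)
      then show ?thesis using m by (simp add: pos_le_divide_eq)
    qed
    obtain \<alpha>' A' b' where "\<alpha>' > 0" "invertible A'" "f \<le> ell (\<lambda>t. t\<^sup>2) \<alpha>' A' b'"
      by (rule gaussian_limit[OF ball slim s1 o ratio]) (rule that)
    then show assertion2
      unfolding assertion2_def gaussian_density_iff by blast
  qed
  have 2: "\<exists>\<alpha> A b. \<alpha> > 0 \<and> invertible A \<and> f \<le> ell (\<lambda>t. t\<^sup>2) \<alpha> A b" if assertion2
    using that unfolding assertion2_def gaussian_density_iff by blast
  have 21: assertion1 if a2: assertion2
  proof -
    obtain \<alpha> A b where G: "\<alpha> > 0" "invertible A" "f \<le> ell (\<lambda>t. t\<^sup>2) \<alpha> A b" using 2[OF a2] by blast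
    \<comment> \<open>Among all s \<ge> 1 the constant of the profile is largest at s = 1, and the
      optimal ratio is at most that of the Gaussian.\<close>
    let ?C = "ennreal (\<alpha> / \<bar>det A\<bar>) * profile.mass (psi_scaled 1) TYPE('n)"
    have "?I s \<le> ?C" if s: "s \<ge> 1" for s
    proof -
      have s0: "s > 0" using s by simp
      obtain \<alpha>' A' b' where o: "optimal (psi_scaled s) f \<alpha>' A' b'" and eq: "loewner_function s f = ell (psi_scaled s) \<alpha>' A' b'"
        using opt[OF s0] by blast
      have "?I s = ennreal (\<alpha>' / \<bar>det A'\<bar>) * profile.mass (psi_scaled s) TYPE('n)"
        unfolding eq using o
        by (intro profile.nn_integral_ell[OF profile_psi_scaled[OF s0]]) (simp_all add: optimal_def)
      also have "\<dots> \<le> ?C"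
        using optimal_psi_scaled_le_gaussian[OF s0 o G] s
        by (intro mult_mono ennreal_leI mass_psi_scaled_antimono) auto
      finally show ?thesis .
    qed
    then have "\<forall>\<^sub>F s in at_top. ?I s \<le> ?C" by (rule eventually_at_top_linorderI)
    then have "Liminf at_top ?I \<le> Liminf at_top (\<lambda>s::real. ?C)" by (rule Liminf_mono)
    also have "\<dots> = ?C" by (rule Liminf_const) simp
    also have "?C < \<infinity>"
      using profile.mass_finite[OF profile_psi_scaled[of 1], where 'm='n] by (simp add: ennreal_mult_less_top)
    finally show ?thesis by (simp add: assertion1_def)
  qed
  have 23: assertion3 if a2: assertion2
  proof -
    obtain \<alpha> A b where o: "optimal (\<lambda>t. t\<^sup>2) f \<alpha> A b"
      using 2[OF a2] square.optimal_exists[OF ball] by blast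
    have "\<exists>!l. solves_loewner_problem \<infinity> f l"
      unfolding solves_loewner_problem_infinity_iff using o square.optimal_unique by (intro ex_ex1I) blast+
    moreover have "uniform_limit UNIV (\<lambda>s. loewner_function s f) l at_top" if "solves_loewner_problem \<infinity> f l" for l
      using that loewner_functions_uniform_limit[OF usc log_concave pos_integral finite_integral]
      unfolding solves_loewner_problem_infinity_iff by blast
    ultimately show ?thesis by (simp add: assertion3_def)
  qed
  have 32: assertion2 if assertion3
    using that by (auto simp: assertion3_def assertion2_def solves_loewner_problem_def gaussian_density_def)
  from 12 21 23 32 show ?thesis by blast
qed

end
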